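(* Let $\mathbf s$ be a sequence in $\widehat{\mathcal S}$ such that $\widehat{\mathcal G}_{J(\mathbf s)}$ satisfies the GKM-property. Let $\varphi(\mathbf s):\Gamma(\mathscr B(\mathbf s))\to\mathcal X(\mathbf s)$ be a $\mathcal Z(J(\mathbf s))$-module isomorphism and $\varphi_x(\mathbf s):\mathscr B(\mathbf s)^x\to\mathcal X(\mathbf s)^x$ ($x\in\widehat{\mathcal W}$) be $S$-module isomorphisms such that $\varphi_x(\mathbf s)(m_x)=\varphi(\mathbf s)(m)|_{I(\mathbf s)_x}$ for all $x\in\widehat{\mathcal W}$ and $m\in\Gamma(\mathscr B(\mathbf s))$ (such isomorphisms exist). Then for any $x\in\widehat{\mathcal W}$, the isomorphism $\varphi_x(\mathbf s)$ restricts to an isomorphism $\mathscr B(\mathbf s)_x\stackrel{\sim}{\to}\mathcal X(\mathbf s)_x$.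
   Context: Affine setting. $R$ is an irreducible reduced finite root system in a finite-dimensional $\mathbb Q$-vector space $V$, with weight lattice $X=\{\lambda\in V:\langle\lambda,\alpha^\vee\rangle\in\mathbb Z\ \forall\alpha\in R\}$, positive roots $R^+$, simple roots $\Pi$, highest root $\tilde\alpha$. The affine Weyl group $\widehat{\mathcal W}$ is the group of transformations of $V^*$ generated by $s_{\alpha,n}(v)=v-(\langle\alpha,v\rangle-n)\alpha^\vee$ ($\alpha\in R,n\in\mathbb Z$). Affine roots: $\widehat R=R\times\mathbb Z\subset\widehat X:=X\oplus\mathbb Z\subset\widehat V:=V\oplus\mathbb Q$, with $s_{(\alpha,-n)}:=s_{\alpha,n}$; $\widehat R^+=\{(\alpha,n):n>0\}\cup\{(\alpha,0):\alpha\in R^+\}$; $\widehat\Pi=\{(\alpha,0):\alpha\in\Pi\}\cup\{(-\tilde\alpha,1)\}$; $\widehat{\mathcal S}=\{s_\gamma:\gamma\in\widehat\Pi\}$. $(\widehat{\mathcal W},\widehat{\mathcal S})$ is a Coxeter system with length $\ell$, Bruhat order $\le$, unit $e$. $\widehat{\mathcal W}$ acts linearly on $\widehat V$ by $s_\alpha(\beta)=\beta-\langle\{\beta\},\{\alpha\}^\vee\rangle\alpha$, where $\{(\lambda,n)\}=\lambda$. $\mathbb F$ is a field of characteristic $\neq2$, $\mathsf V=\widehat X\otimes_{\mathbb Z}\mathbb F$, $S$ is the symmetric algebra of $\mathsf V$, $\mathbb Z$-graded with $\mathsf V$ in degree $2$; $\bar\lambda:=\lambda\otimes1$ for $\lambda\in\widehat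 X$. The moment graph $\widehat{\mathcal G}$ has vertex poset $(\widehat{\mathcal W},\le)$ and an edge $x\to y$ labelled $\bar\alpha$ iff $x<y$ and $y=s_\alpha x$, $\alpha\in\widehat R^+$. If $E$ is an edge between $x$ and $y$ then $Es$ denotes the edge between $xs$ and $ys$. For $s\in\widehat{\mathcal S}$, $\widehat{\mathcal G}^s$ has vertices $\bar x=\{x,xs\}$, order: $\bar x<\bar y$ iff $\bar x\ne\bar y$ and $u<v$ for some $u\in\bar x,v\in\bar y$; an edge $\bar x\to\bar y$ labelled $\bar\alpha$ iff $\bar x<\bar y$ and $s_\alpha\bar x=\bar y$, $\alpha\in\widehat R^+$; $\bar E$ denotes the edge induced by $E:x\to y$. $\widehat{\mathcal G}_\Omega$ is the full subgraph on $\Omega\subset\widehat{\mathcal W}$. GKM-property: labels of any two distinct edges with a common vertex are not proportional over $\mathbb F$. Sheaves. A sheaf $\mathscr M$ on a moment graph consists of graded $S$-modules $\mathscr M^x$ (vertices $x$), graded $S$-modules $\mathscr M^E$ with $l(E)\mathscr M^E=0$ (edges $E$ with label $l(E)$), and degree-$0$ homomorphisms $\rho_{x,E}:\mathscr M^x\to\mathscr M^E$ for $x$ on $E$. For a set $\mathcal I$ of vertices, $\Gamma(\mathcal I,\mathscr M)=\{m\in\prod_{x\in\mathcal I}\mathscr M^x:\rho_{x,E}(m_x)=\rho_{y,E}(m_y)$ for all edges $E$ joining $x,y\in\mathcal I\}$; $\Gamma(\mathscr M)$ is the case of all vertices. $\mathscr M_x:=\{m\in\mathscr M^x:\rho_{x,E}(m)=0$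 for all edges $E$ containing $x\}$. Bott–Samelson sheaves. $\vartheta^s_{on}\mathscr P=\mathscr N$ is the sheaf on $\widehat{\mathcal G}^s$ with $\mathscr N^{\bar x}=\Gamma(\{x,xs\},\mathscr P)$; for $\bar E:\bar x\to\bar y$ induced by $E:x\to y$, $\mathscr N^{\bar E}$ is the image of $\mathscr N^{\bar y}$ under $\rho_{y,E}\oplus\rho_{ys,Es}$, and $\rho_{\bar y,\bar E},\rho_{\bar x,\bar E}$ are the restrictions of $\rho_{y,E}\oplus\rho_{ys,Es}$, $\rho_{x,E}\oplus\rho_{xs,Es}$. $\vartheta^s_{out}\mathscr Q=\mathscr M$ is the sheaf on $\widehat{\mathcal G}$ with $\mathscr M^x=\mathscr Q^{\bar x}$; if $E$ joins $x$ and $xs$, $\mathscr M^E=\mathscr Q^{\bar x}/l(E)\mathscr Q^{\bar x}$ with natural projections; otherwise $\mathscr M^E=\mathscr Q^{\bar E}$ with $\rho_{x,E}=\rho_{\bar x,\bar E}$. $\vartheta^s=\vartheta^s_{out}\circ\vartheta^s_{on}$. $\mathscr B(e)$ is the sheaf with $\mathscr B(e)^e=S$ and all other $\mathscr B(e)^x$, $\mathscr B(e)^E$ zero. For $\mathbf s=(s_1,\dots,s_l)$ with $\widehat{\mathcal G}_{J(\mathbf s)}$ GKM, $\mathscr B(\mathbf s):=\vartheta^{s_l}\circ\cdots\circ\vartheta^{s_1}\mathscr B(e)$ (this is well defined, with support in $J(\mathbf s)$). Sequences. A subsequence of $\mathbf s=(s_1,\dots,s_l)$ is obtained by replacing some entries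 by the blank symbol $\ast$; $I(\mathbf s)$ is the set of all $2^l$ subsequences; $\operatorname{ev}(\sigma)\in\widehat{\mathcal W}$ is the ordered product of the non-blank entries of $\sigma$; $I(\mathbf s)_x=\{\sigma\in I(\mathbf s):\operatorname{ev}(\sigma)=x\}$; $J(\mathbf s)=\{\operatorname{ev}(\sigma):\sigma\in I(\mathbf s)\}$; $\mathbf s'=(s_1,\dots,s_{l-1})$. Structure algebra and $\mathcal X(\mathbf s)$. For $\mathcal I\subset\widehat{\mathcal W}$, $\mathcal Z(\mathcal I)=\{z\in\prod_{x\in\mathcal I}S: z_x\equiv z_{s_\alpha x}\ (\mathrm{mod}\ \bar\alpha)$ whenever $\alpha\in\widehat R$, $x,s_\alpha x\in\mathcal I\}$, acting componentwise on $\Gamma(\mathscr M)$ when $\operatorname{supp}\mathscr M\subset\mathcal I$, and on $\bigoplus_{\sigma\in I(\mathbf s)}S$ (for $J(\mathbf s)\subset\mathcal I$) by $(zf)_\sigma=z_{\operatorname{ev}(\sigma)}f_\sigma$. For $\lambda\in\widehat X$, $c^\lambda$ is the element with $c^\lambda_x=\overline{x(\lambda)}$. $\Delta:\bigoplus_{\sigma\in I(\mathbf s')}S\to\bigoplus_{\sigma\in I(\mathbf s)}S$ is $\Delta(f)_{\sigma\ast}=\Delta(f)_{\sigma s_l}=f_\sigma$. $\mathcal X(\emptyset)=\bigoplus_{\sigma\in I(\emptyset)}S\cong S$, and $\mathcal X(\mathbf s)=\Delta(\mathcal X(\mathbf s'))+c^{\alpha_l}\Delta(\mathcal X(\mathbf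 s'))$ for $\mathbf s\neq\emptyset$, where $\alpha_l\in\widehat\Pi$, $s_l=s_{\alpha_l}$. $\mathcal X(\mathbf s)^x:=\{f|_{I(\mathbf s)_x}:f\in\mathcal X(\mathbf s)\}$ and $\mathcal X(\mathbf s)_x:=\{f|_{I(\mathbf s)_x}:f\in\mathcal X(\mathbf s),\ f|_{I(\mathbf s)\setminus I(\mathbf s)_x}=0\}$. *)

theory Defs
  imports
    Complex_Main
    "HOL-Algebra.Bij"
    "HOL-Algebra.Generated_Groups"
    "HOL-Algebra.QuotRing"
    "HOL-Algebra.Module"
    "HOL-Library.Poly_Mapping"
    "HOL-Library.Product_Plus"
begin

section \<open>Graded modules\<close>

text \<open>As everywhere in HOL-Algebra, the ring fields \<open>mult\<close> and \<open>one\<close> of a module record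
  carry no information. Homogeneous components are recorded in \<open>grade\<close>.\<close>

record ('a, 'b) graded_module = "('a, 'b) module" +
  grade :: "int \<Rightarrow> 'b set"

definition restrict_module ::
  "('a, 'b) graded_module \<Rightarrow> 'b set \<Rightarrow> ('a, 'b) graded_module" where
  "restrict_module M A = M\<lparr>carrier := A, grade := (\<lambda>k. A \<inter> grade M k)\<rparr>"

definition product_module ::
  "'i set \<Rightarrow> ('i \<Rightarrow> ('a, 'b) graded_module) \<Rightarrow> ('a, 'i \<Rightarrow> 'b) graded_module" where
  "product_module I M =
    \<lparr>carrier = (\<Pi>\<^sub>E i\<in>I. carrier (M i)),
     mult = undefined, one = undefined,
     zero = (\<lambda>i\<in>I. \<zero>\<^bsub>M i\<^esub>),
     add = (\<lambda>f g. \<lambda>i\<in>I. f i \<oplus>\<^bsub>M i\<^esub> g i),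
     smult = (\<lambda>a f. \<lambda>i\<in>I. a \<odot>\<^bsub>M i\<^esub> f i),
     grade = (\<lambda>k. \<Pi>\<^sub>E i\<in>I. grade (M i) k)\<rparr>"

definition quotient_module ::
  "('a, 'b, 'c) module_scheme \<Rightarrow> 'b set \<Rightarrow> ('a, 'b set) module" where
  "quotient_module M N =
    \<lparr>carrier = a_rcosets\<^bsub>M\<^esub> N,
     mult = undefined, one = undefined,
     zero = N,
     add = set_add M,
     smult = (\<lambda>a C. \<Union>m\<in>C. N +>\<^bsub>M\<^esub> (a \<odot>\<^bsub>M\<^esub> m))\<rparr>"

definition graded_quotient_module ::
  "('a, 'b) graded_module \<Rightarrow> 'b set \<Rightarrow> ('a, 'b set) graded_module" where
  "graded_quotient_module M N =
     module.extend (quotient_module M N)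
       (graded_module.fields (\<lambda>k. (\<lambda>m. N +>\<^bsub>M\<^esub> m) ` grade M k))"

text \<open>The copy of \<open>M\<close> along an injection \<open>h\<close> with left inverse \<open>g\<close>.\<close>

definition transport_module ::
  "('b \<Rightarrow> 'c) \<Rightarrow> ('c \<Rightarrow> 'b) \<Rightarrow> ('a, 'b) graded_module \<Rightarrow> ('a, 'c) graded_module" where
  "transport_module h g M =
    \<lparr>carrier = h ` carrier M,
     mult = undefined, one = undefined,
     zero = h \<zero>\<^bsub>M\<^esub>,
     add = (\<lambda>x y. h (g x \<oplus>\<^bsub>M\<^esub> g y)),
     smult = (\<lambda>a x. h (a \<odot>\<^bsub>M\<^esub> g x)),
     grade = (\<lambda>k. h ` grade M k)\<rparr>"

definition zero_module :: "'b \<Rightarrow> ('a, 'b) graded_module" where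
  "zero_module z =
    \<lparr>carrier = {z}, mult = undefined, one = undefined, zero = z,
     add = (\<lambda>_ _. z), smult = (\<lambda>_ _. z), grade = (\<lambda>_. {z})\<rparr>"

text \<open>The same abelian group with scalars acting through \<open>act\<close>, possibly from another ring.\<close>

definition with_scalars ::
  "('r \<Rightarrow> 'b \<Rightarrow> 'b) \<Rightarrow> ('a, 'b) graded_module \<Rightarrow> ('r, 'b) module" where
  "with_scalars act M =
    \<lparr>carrier = carrier M, mult = undefined, one = undefined, zero = zero M,
     add = add M, smult = act\<rparr>"

definition module_iso ::
  "('a, 'r) ring_scheme \<Rightarrow> ('a, 'b, 'm) module_scheme \<Rightarrow> ('a, 'c, 'n) module_scheme
     \<Rightarrow> ('b \<Rightarrow> 'c) set" where
  "module_iso R M N =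
    {h. bij_betw h (carrier M) (carrier N) \<and>
        (\<forall>x\<in>carrier M. \<forall>y\<in>carrier M. h (x \<oplus>\<^bsub>M\<^esub> y) = h x \<oplus>\<^bsub>N\<^esub> h y) \<and>
        (\<forall>a\<in>carrier R. \<forall>x\<in>carrier M. h (a \<odot>\<^bsub>M\<^esub> x) = a \<odot>\<^bsub>N\<^esub> h x)}"


section \<open>Base change of an abelian group and symmetric algebras\<close>

text \<open>\<open>L \<otimes>\<^sub>\<int> \<F>\<close> for an additive subgroup \<open>L\<close>: the \<open>\<F>\<close>-space on symbols
  \<open>a \<otimes> 1\<close>, \<open>a \<in> L\<close>, modulo additivity in \<open>a\<close>. The basis vector \<open>a \<otimes> 1\<close>
  is \<^term>\<open>Poly_Mapping.single a 1\<close>.\<close>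

definition free_space :: "'x set \<Rightarrow> ('f::field, 'x \<Rightarrow>\<^sub>0 'f) module" where
  "free_space L =
    \<lparr>carrier = {p. Poly_Mapping.keys p \<subseteq> L}, mult = undefined, one = undefined,
     zero = 0, add = (+), smult = (\<lambda>c. Poly_Mapping.map ((*) c))\<rparr>"

definition tensor_relations :: "'x::ab_group_add set \<Rightarrow> ('x \<Rightarrow>\<^sub>0 'f::field) set" where
  "tensor_relations L =
    module.span (\<lambda>c. Poly_Mapping.map ((*) c))
      {Poly_Mapping.single (a + b) 1 - Poly_Mapping.single a 1 - Poly_Mapping.single b 1
        | a b. a \<in> L \<and> b \<in> L}"

definition base_change ::
  "'x::ab_group_add set \<Rightarrow> ('f::field, ('x \<Rightarrow>\<^sub>0 'f) set) module" where
  "base_change L = quotient_module (free_space L) (tensor_relations L)"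

definition tensor_one :: "'x::ab_group_add set \<Rightarrow> 'x \<Rightarrow> ('x \<Rightarrow>\<^sub>0 'f::field) set" where
  "tensor_one L a =
    tensor_relations L +>\<^bsub>(free_space L :: ('f, 'x \<Rightarrow>\<^sub>0 'f) module)\<^esub> Poly_Mapping.single a 1"

definition poly_ring :: "'b set \<Rightarrow> (('b \<Rightarrow>\<^sub>0 nat) \<Rightarrow>\<^sub>0 'f::field) ring" where
  "poly_ring B =
    \<lparr>carrier = {p. \<forall>m\<in>Poly_Mapping.keys p. Poly_Mapping.keys m \<subseteq> B},
     mult = (*), one = 1, zero = 0, add = (+)\<rparr>"

definition homogeneous_polys :: "'b set \<Rightarrow> nat \<Rightarrow> (('b \<Rightarrow>\<^sub>0 nat) \<Rightarrow>\<^sub>0 'f::field) set" where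
  "homogeneous_polys B d =
    {p \<in> carrier (poly_ring B). \<forall>m\<in>Poly_Mapping.keys p.
       (\<Sum>b\<in>Poly_Mapping.keys m. Poly_Mapping.lookup m b) = d}"

definition poly_var :: "'b \<Rightarrow> (('b \<Rightarrow>\<^sub>0 nat) \<Rightarrow>\<^sub>0 'f::field)" where
  "poly_var b = Poly_Mapping.single (Poly_Mapping.single b 1) 1"

text \<open>The symmetric algebra of an \<open>\<F>\<close>-space \<open>M\<close>: polynomials in the elements of \<open>M\<close>,
  modulo the relations that make \<open>M\<close> embed linearly.\<close>

definition symmetric_ideal :: "('f::field, 'b) module \<Rightarrow> (('b \<Rightarrow>\<^sub>0 nat) \<Rightarrow>\<^sub>0 'f) set" where
  "symmetric_ideal M = genideal (poly_ring (carrier M))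
    ({poly_var (v \<oplus>\<^bsub>M\<^esub> w) - poly_var v - poly_var w
        | v w. v \<in> carrier M \<and> w \<in> carrier M} \<union>
     {poly_var (c \<odot>\<^bsub>M\<^esub> v) - Poly_Mapping.single 0 c * poly_var v
        | c v. v \<in> carrier M})"

definition symmetric_algebra ::
  "('f::field, 'b) module \<Rightarrow> (('b \<Rightarrow>\<^sub>0 nat) \<Rightarrow>\<^sub>0 'f) set ring" where
  "symmetric_algebra M = poly_ring (carrier M) Quot symmetric_ideal M"

definition symmetric_embedding ::
  "('f::field, 'b) module \<Rightarrow> 'b \<Rightarrow> (('b \<Rightarrow>\<^sub>0 nat) \<Rightarrow>\<^sub>0 'f) set" where
  "symmetric_embedding M v =
    symmetric_ideal M +>\<^bsub>(poly_ring (carrier M) :: (('b \<Rightarrow>\<^sub>0 nat) \<Rightarrow>\<^sub>0 'f) ring)\<^esub> poly_var v"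

text \<open>The symmetric algebra as a graded module over itself; \<open>M\<close> sits in degree 2.\<close>

definition symmetric_regular_module ::
  "('f::field, 'b) module
     \<Rightarrow> ((('b \<Rightarrow>\<^sub>0 nat) \<Rightarrow>\<^sub>0 'f) set, (('b \<Rightarrow>\<^sub>0 nat) \<Rightarrow>\<^sub>0 'f) set) graded_module" where
  "symmetric_regular_module M =
    \<lparr>carrier = carrier (symmetric_algebra M),
     mult = mult (symmetric_algebra M), one = one (symmetric_algebra M),
     zero = zero (symmetric_algebra M), add = add (symmetric_algebra M),
     smult = mult (symmetric_algebra M),
     grade = (\<lambda>k. if 0 \<le> k \<and> even k
       then (\<lambda>p. symmetric_ideal M +>\<^bsub>poly_ring (carrier M)\<^esub> p)
              ` homogeneous_polys (carrier M) (nat (k div 2))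
       else {zero (symmetric_algebra M)})\<rparr>"


section \<open>Root systems and the affine Weyl group\<close>

text \<open>\<open>V\<close> is the whole type \<^typ>\<open>'v\<close> with scalar multiplication \<open>scl\<close>;
  \<open>coroot D \<alpha> \<mu>\<close> is \<open>\<langle>\<mu>, \<alpha>\<^sup>\<or>\<rangle>\<close>. A coroot is determined by the
  root system; values of \<open>coroot\<close> outside the roots are irrelevant.\<close>

record 'v root_data =
  scl :: "rat \<Rightarrow> 'v \<Rightarrow> 'v"
  roots :: "'v set"
  coroot :: "'v \<Rightarrow> 'v \<Rightarrow> rat"
  simple_roots :: "'v set"

definition is_root_system :: "'v::ab_group_add root_data \<Rightarrow> bool" where
  "is_root_system D \<longleftrightarrow>
    vector_space (scl D) \<and>
    finite (roots D) \<and> 0 \<notin> roots D \<and>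
    module.span (scl D) (roots D) = UNIV \<and>
    (\<forall>\<alpha>\<in>roots D.
       Vector_Spaces.linear (scl D) (*) (coroot D \<alpha>) \<and>
       coroot D \<alpha> \<alpha> = 2 \<and>
       (\<lambda>\<beta>. \<beta> - scl D (coroot D \<alpha> \<beta>) \<alpha>) ` roots D = roots D \<and>
       (\<forall>\<beta>\<in>roots D. coroot D \<alpha> \<beta> \<in> \<int>))"

definition is_reduced :: "'v::ab_group_add root_data \<Rightarrow> bool" where
  "is_reduced D \<longleftrightarrow> (\<forall>\<alpha>\<in>roots D. \<forall>c. scl D c \<alpha> \<in> roots D \<longrightarrow> c = 1 \<or> c = -1)"

definition is_irreducible :: "'v::ab_group_add root_data \<Rightarrow> bool" where
  "is_irreducible D \<longleftrightarrow> roots D \<noteq> {} \<and>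
    (\<forall>A B. A \<union> B = roots D \<and> A \<inter> B = {} \<and> A \<noteq> {} \<and> B \<noteq> {} \<longrightarrow>
       (\<exists>\<alpha>\<in>A. \<exists>\<beta>\<in>B. coroot D \<beta> \<alpha> \<noteq> 0))"

definition nonneg_combinations :: "'v::ab_group_add root_data \<Rightarrow> 'v set" where
  "nonneg_combinations D =
    {(\<Sum>\<beta>\<in>simple_roots D. scl D (of_nat (k \<beta>)) \<beta>) | k :: 'v \<Rightarrow> nat. True}"

definition is_simple_system :: "'v::ab_group_add root_data \<Rightarrow> bool" where
  "is_simple_system D \<longleftrightarrow>
    simple_roots D \<subseteq> roots D \<and>
    \<not> module.dependent (scl D) (simple_roots D) \<and>
    (\<forall>\<alpha>\<in>roots D. \<alpha> \<in> nonneg_combinations D \<or> - \<alpha> \<in> nonneg_combinations D)"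

definition positive_roots :: "'v::ab_group_add root_data \<Rightarrow> 'v set" where
  "positive_roots D = roots D \<inter> nonneg_combinations D"

definition highest_root :: "'v::ab_group_add root_data \<Rightarrow> 'v" where
  "highest_root D =
    (THE \<theta>. \<theta> \<in> roots D \<and> (\<forall>\<alpha>\<in>roots D. \<theta> - \<alpha> \<in> nonneg_combinations D))"

definition weight_lattice :: "'v::ab_group_add root_data \<Rightarrow> 'v set" where
  "weight_lattice D = {\<mu>. \<forall>\<alpha>\<in>roots D. coroot D \<alpha> \<mu> \<in> \<int>}"

text \<open>\<open>V \<oplus> \<rat>\<close> is \<^typ>\<open>'v \<times> rat\<close>; integral second components are those in \<^term>\<open>\<int>\<close>.\<close>

definition affine_lattice :: "'v::ab_group_add root_data \<Rightarrow> ('v \<times> rat) set" where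
  "affine_lattice D = weight_lattice D \<times> \<int>"

definition affine_roots :: "'v::ab_group_add root_data \<Rightarrow> ('v \<times> rat) set" where
  "affine_roots D = roots D \<times> \<int>"

definition positive_affine_roots :: "'v::ab_group_add root_data \<Rightarrow> ('v \<times> rat) set" where
  "positive_affine_roots D =
    {(\<alpha>, n). \<alpha> \<in> roots D \<and> n \<in> \<int> \<and> n > 0} \<union> {(\<alpha>, 0) | \<alpha>. \<alpha> \<in> positive_roots D}"

definition simple_affine_roots :: "'v::ab_group_add root_data \<Rightarrow> ('v \<times> rat) set" where
  "simple_affine_roots D =
    {(\<alpha>, 0) | \<alpha>. \<alpha> \<in> simple_roots D} \<union> {(- highest_root D, 1)}"

definition dual_space :: "'v::ab_group_add root_data \<Rightarrow> ('v \<Rightarrow> rat) set" where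
  "dual_space D = {v. Vector_Spaces.linear (scl D) (*) v}"

type_synonym 'v weyl_elt = "('v \<Rightarrow> rat) \<Rightarrow> ('v \<Rightarrow> rat)"

text \<open>\<open>s\<^bsub>(\<alpha>,m)\<^esub> = s\<^bsub>\<alpha>,-m\<^esub>\<close> maps \<open>v\<close> to
  \<open>v - (\<langle>\<alpha>,v\<rangle> + m) \<alpha>\<^sup>\<or>\<close>.\<close>

definition affine_reflection ::
  "'v::ab_group_add root_data \<Rightarrow> 'v \<times> rat \<Rightarrow> 'v weyl_elt" where
  "affine_reflection D \<gamma> =
    (\<lambda>v\<in>dual_space D. \<lambda>\<mu>. v \<mu> - (v (fst \<gamma>) + snd \<gamma>) * coroot D (fst \<gamma>) \<mu>)"

definition affine_weyl_group :: "'v::ab_group_add root_data \<Rightarrow> 'v weyl_elt monoid" where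
  "affine_weyl_group D =
    (BijGroup (dual_space D))
      \<lparr>carrier := generate (BijGroup (dual_space D)) (affine_reflection D ` affine_roots D)\<rparr>"

definition simple_reflections :: "'v::ab_group_add root_data \<Rightarrow> 'v weyl_elt set" where
  "simple_reflections D = affine_reflection D ` simple_affine_roots D"

definition coxeter_length :: "('w, 'm) monoid_scheme \<Rightarrow> 'w set \<Rightarrow> 'w \<Rightarrow> nat" where
  "coxeter_length W S w =
    (LEAST n. \<exists>ss. set ss \<subseteq> S \<and> length ss = n \<and> foldr (\<lambda>s u. s \<otimes>\<^bsub>W\<^esub> u) ss \<one>\<^bsub>W\<^esub> = w)"

definition coxeter_reflections :: "('w, 'm) monoid_scheme \<Rightarrow> 'w set \<Rightarrow> 'w set" where
  "coxeter_reflections W S = {g \<otimes>\<^bsub>W\<^esub> s \<otimes>\<^bsub>W\<^esub> inv\<^bsub>W\<^esub> g | g s. g \<in> carrier W \<and> s \<in> S}"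

definition bruhat_step :: "('w, 'm) monoid_scheme \<Rightarrow> 'w set \<Rightarrow> 'w \<Rightarrow> 'w \<Rightarrow> bool" where
  "bruhat_step W S u w \<longleftrightarrow>
    u \<in> carrier W \<and> (\<exists>t\<in>coxeter_reflections W S. w = t \<otimes>\<^bsub>W\<^esub> u) \<and>
    coxeter_length W S u < coxeter_length W S w"

definition bruhat_less :: "('w, 'm) monoid_scheme \<Rightarrow> 'w set \<Rightarrow> 'w \<Rightarrow> 'w \<Rightarrow> bool" where
  "bruhat_less W S = (bruhat_step W S)\<^sup>+\<^sup>+"

definition linear_reflection ::
  "'v::ab_group_add root_data \<Rightarrow> 'v \<times> rat \<Rightarrow> 'v \<times> rat \<Rightarrow> 'v \<times> rat" where
  "linear_reflection D \<gamma> \<beta> =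
    (let c = coroot D (fst \<gamma>) (fst \<beta>)
     in (fst \<beta> - scl D c (fst \<gamma>), snd \<beta> - c * snd \<gamma>))"

text \<open>The graph of the homomorphism from the affine Weyl group to the linear transformations
  of \<open>V \<oplus> \<rat>\<close> which sends \<open>s\<^sub>\<gamma>\<close> to \<^term>\<open>linear_reflection D \<gamma>\<close>.\<close>

inductive linear_action_graph ::
  "'v::ab_group_add root_data \<Rightarrow> 'v weyl_elt \<Rightarrow> ('v \<times> rat \<Rightarrow> 'v \<times> rat) \<Rightarrow> bool"
  for D where
  unit: "linear_action_graph D \<one>\<^bsub>affine_weyl_group D\<^esub> id"
| step: "linear_action_graph D w f \<Longrightarrow> \<gamma> \<in> affine_roots D \<Longrightarrow>
    linear_action_graph D (affine_reflection D \<gamma> \<otimes>\<^bsub>affine_weyl_group D\<^esub> w)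
      (linear_reflection D \<gamma> \<circ> f)"

definition linear_action ::
  "'v::ab_group_add root_data \<Rightarrow> 'v weyl_elt \<Rightarrow> 'v \<times> rat \<Rightarrow> 'v \<times> rat" where
  "linear_action D w = (THE f. linear_action_graph D w f)"

type_synonym ('v, 'f) label = "('v \<times> rat \<Rightarrow>\<^sub>0 'f) set"
type_synonym ('v, 'f) scalar = "((('v, 'f) label \<Rightarrow>\<^sub>0 nat) \<Rightarrow>\<^sub>0 'f) set"

definition label_space ::
  "'v::ab_group_add root_data \<Rightarrow> ('f::field, ('v, 'f) label) module" where
  "label_space D = base_change (affine_lattice D)"

definition lattice_bar ::
  "'v::ab_group_add root_data \<Rightarrow> 'v \<times> rat \<Rightarrow> ('v, 'f::field) label" where
  "lattice_bar D = tensor_one (affine_lattice D)"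

definition scalars ::
  "'v::ab_group_add root_data \<Rightarrow> ('v, 'f::field) scalar ring" where
  "scalars D = symmetric_algebra (label_space D)"

definition scalar_module ::
  "'v::ab_group_add root_data
     \<Rightarrow> (('v, 'f::field) scalar, ('v, 'f) scalar) graded_module" where
  "scalar_module D = symmetric_regular_module (label_space D)"

definition label_scalar ::
  "'v::ab_group_add root_data \<Rightarrow> ('v, 'f::field) label \<Rightarrow> ('v, 'f) scalar" where
  "label_scalar D = symmetric_embedding (label_space D)"


section \<open>Moment graphs and sheaves\<close>

text \<open>An edge \<open>(x, l, y)\<close> is \<open>x \<rightarrow> y\<close> with label \<open>l\<close>.\<close>

type_synonym ('v, 'l) edge = "'v \<times> 'l \<times> 'v"

definition edge_source :: "('v, 'l) edge \<Rightarrow> 'v" where "edge_source E = fst E"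
definition edge_label :: "('v, 'l) edge \<Rightarrow> 'l" where "edge_label E = fst (snd E)"
definition edge_target :: "('v, 'l) edge \<Rightarrow> 'v" where "edge_target E = snd (snd E)"
definition ends :: "('v, 'l) edge \<Rightarrow> 'v set" where
  "ends E = {edge_source E, edge_target E}"

record ('v, 'l) moment_graph =
  verts :: "'v set"
  vless :: "'v \<Rightarrow> 'v \<Rightarrow> bool"
  edges :: "('v, 'l) edge set"

definition full_subgraph ::
  "('v, 'l) moment_graph \<Rightarrow> 'v set \<Rightarrow> ('v, 'l) moment_graph" where
  "full_subgraph G \<Omega> =
    \<lparr>verts = verts G \<inter> \<Omega>, vless = vless G, edges = {E \<in> edges G. ends E \<subseteq> \<Omega>}\<rparr>"

definition proportional :: "('f, 'l) module \<Rightarrow> 'l \<Rightarrow> 'l \<Rightarrow> bool" where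
  "proportional M k l \<longleftrightarrow> (\<exists>c. k = c \<odot>\<^bsub>M\<^esub> l \<or> l = c \<odot>\<^bsub>M\<^esub> k)"

definition GKM_property :: "('f, 'l) module \<Rightarrow> ('v, 'l) moment_graph \<Rightarrow> bool" where
  "GKM_property M G \<longleftrightarrow>
    (\<forall>E\<in>edges G. \<forall>E'\<in>edges G. E \<noteq> E' \<and> ends E \<inter> ends E' \<noteq> {} \<longrightarrow>
       \<not> proportional M (edge_label E) (edge_label E'))"

record ('v, 'l, 'a, 'm, 'n) sheaf =
  stalk :: "'v \<Rightarrow> ('a, 'm) graded_module"
  edge_stalk :: "('v, 'l) edge \<Rightarrow> ('a, 'n) graded_module"
  rho :: "'v \<Rightarrow> ('v, 'l) edge \<Rightarrow> 'm \<Rightarrow> 'n"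

definition sections_over ::
  "('v, 'l) moment_graph \<Rightarrow> ('v, 'l, 'a, 'm, 'n) sheaf \<Rightarrow> 'v set \<Rightarrow> ('v \<Rightarrow> 'm) set" where
  "sections_over G M I =
    {m \<in> (\<Pi>\<^sub>E x\<in>I. carrier (stalk M x)). \<forall>E\<in>edges G. ends E \<subseteq> I \<longrightarrow>
       rho M (edge_source E) E (m (edge_source E)) = rho M (edge_target E) E (m (edge_target E))}"

definition section_module ::
  "('v, 'l) moment_graph \<Rightarrow> ('v, 'l, 'a, 'm, 'n) sheaf \<Rightarrow> 'v set
     \<Rightarrow> ('a, 'v \<Rightarrow> 'm) graded_module" where
  "section_module G M I =
    restrict_module (product_module I (stalk M)) (sections_over G M I)"

text \<open>\<open>\<M>\<^sub>x\<close>, the sections supported at \<open>x\<close>.\<close>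

definition costalk ::
  "('v, 'l) moment_graph \<Rightarrow> ('v, 'l, 'a, 'm, 'n) sheaf \<Rightarrow> 'v \<Rightarrow> ('a, 'm) graded_module" where
  "costalk G M x = restrict_module (stalk M x)
    {m \<in> carrier (stalk M x). \<forall>E\<in>edges G. x \<in> ends E \<longrightarrow> rho M x E m = \<zero>\<^bsub>edge_stalk M E\<^esub>}"


section \<open>The affine moment graphs\<close>

definition affine_moment_graph ::
  "'v::ab_group_add root_data \<Rightarrow> ('v weyl_elt, ('v, 'f::field) label) moment_graph" where
  "affine_moment_graph D =
    (let W = affine_weyl_group D; less = bruhat_less W (simple_reflections D) in
     \<lparr>verts = carrier W,
      vless = less,
      edges = {(x, lattice_bar D \<alpha>, y) | x \<alpha> y.
        x \<in> carrier W \<and> y \<in> carrier W \<and> \<alpha> \<in> positive_affine_roots D \<and>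
        less x y \<and> y = affine_reflection D \<alpha> \<otimes>\<^bsub>W\<^esub> x}\<rparr>)"

definition coset_pair ::
  "'v::ab_group_add root_data \<Rightarrow> 'v weyl_elt \<Rightarrow> 'v weyl_elt \<Rightarrow> 'v weyl_elt set" where
  "coset_pair D s x = {x, x \<otimes>\<^bsub>affine_weyl_group D\<^esub> s}"

definition quotient_moment_graph ::
  "'v::ab_group_add root_data \<Rightarrow> 'v weyl_elt
     \<Rightarrow> ('v weyl_elt set, ('v, 'f::field) label) moment_graph" where
  "quotient_moment_graph D s =
    (let W = affine_weyl_group D;
         vs = coset_pair D s ` carrier W;
         less = (\<lambda>X Y. X \<noteq> Y \<and> (\<exists>u\<in>X. \<exists>v\<in>Y. bruhat_less W (simple_reflections D) u v)) in
     \<lparr>verts = vs,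
      vless = less,
      edges = {(X, lattice_bar D \<alpha>, Y) | X \<alpha> Y.
        X \<in> vs \<and> Y \<in> vs \<and> \<alpha> \<in> positive_affine_roots D \<and>
        less X Y \<and> (\<lambda>z. affine_reflection D \<alpha> \<otimes>\<^bsub>W\<^esub> z) ` X = Y}\<rparr>)"

definition induced_edge ::
  "'v::ab_group_add root_data \<Rightarrow> 'v weyl_elt \<Rightarrow> ('v weyl_elt, 'l) edge
     \<Rightarrow> ('v weyl_elt set, 'l) edge" where
  "induced_edge D s E =
    (coset_pair D s (edge_source E), edge_label E, coset_pair D s (edge_target E))"

text \<open>For the edge induced by \<open>E\<close> this is \<open>{E, Es}\<close>.\<close>

definition edge_lifts ::
  "'v::ab_group_add root_data \<Rightarrow> 'v weyl_elt \<Rightarrow> ('v weyl_elt set, ('v, 'f::field) label) edge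
     \<Rightarrow> ('v weyl_elt, ('v, 'f) label) edge set" where
  "edge_lifts D s F = {E \<in> edges (affine_moment_graph D). induced_edge D s E = F}"


section \<open>Bott--Samelson sheaves\<close>

text \<open>Stalks of iterated translations are iterated families of stalks, so an element type closed
  under forming families is needed. Elements of stalks on vertices are families, indexed by Weyl
  group elements, of scalars; elements of stalks on edges are families, indexed by edges, of
  cosets.\<close>

datatype ('i, 'a) family = Elem (un_Elem: 'a) | Family (un_Family: "'i \<Rightarrow> ('i, 'a) family")

type_synonym ('v, 'f) stalk_elt = "('v weyl_elt, ('v, 'f) scalar) family"
type_synonym ('v, 'f) edge_elt =
  "(('v weyl_elt, ('v, 'f) label) edge, ('v, 'f) stalk_elt set) family"
type_synonym ('v, 'f) affine_sheaf =
  "('v weyl_elt, ('v, 'f) label, ('v, 'f) scalar,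
    ('v, 'f) stalk_elt, ('v, 'f) edge_elt) sheaf"
type_synonym ('v, 'f) quotient_sheaf =
  "('v weyl_elt set, ('v, 'f) label, ('v, 'f) scalar,
    ('v, 'f) stalk_elt, ('v, 'f) edge_elt) sheaf"

definition unit_sheaf :: "'v::ab_group_add root_data \<Rightarrow> ('v, 'f::field) affine_sheaf" where
  "unit_sheaf D =
    \<lparr>stalk = (\<lambda>x. if x = \<one>\<^bsub>affine_weyl_group D\<^esub>
       then transport_module Elem un_Elem (scalar_module D)
       else zero_module (Elem \<zero>\<^bsub>scalars D\<^esub>)),
     edge_stalk = (\<lambda>E. zero_module (Elem {})),
     rho = (\<lambda>x E m. Elem {})\<rparr>"

text \<open>\<open>\<rho>\<^bsub>y,E\<^esub> \<oplus> \<rho>\<^bsub>ys,Es\<^esub>\<close> on \<open>\<Gamma>({y,ys},\<P>)\<close>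
  for either end \<open>Y = {y,ys}\<close> of the induced edge \<open>F\<close>.\<close>

definition theta_on_rho ::
  "'v::ab_group_add root_data \<Rightarrow> 'v weyl_elt \<Rightarrow> ('v, 'f::field) affine_sheaf
     \<Rightarrow> 'v weyl_elt set \<Rightarrow> ('v weyl_elt set, ('v, 'f) label) edge
     \<Rightarrow> ('v, 'f) stalk_elt \<Rightarrow> ('v, 'f) edge_elt" where
  "theta_on_rho D s P Y F m =
    Family (\<lambda>E\<in>edge_lifts D s F.
      let z = (THE z. z \<in> Y \<and> z \<in> ends E) in rho P z E (un_Family m z))"

definition theta_on_stalk ::
  "'v::ab_group_add root_data \<Rightarrow> ('v, 'f::field) affine_sheaf
     \<Rightarrow> 'v weyl_elt set \<Rightarrow> (('v, 'f) scalar, ('v, 'f) stalk_elt) graded_module" where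
  "theta_on_stalk D P X =
    transport_module Family un_Family (section_module (affine_moment_graph D) P X)"

definition theta_on ::
  "'v::ab_group_add root_data \<Rightarrow> 'v weyl_elt \<Rightarrow> ('v, 'f::field) affine_sheaf
     \<Rightarrow> ('v, 'f) quotient_sheaf" where
  "theta_on D s P =
    (let G = quotient_moment_graph D s in
     \<lparr>stalk = (\<lambda>X\<in>verts G. theta_on_stalk D P X),
      edge_stalk = (\<lambda>F\<in>edges G.
        restrict_module
          (transport_module Family un_Family (product_module (edge_lifts D s F) (edge_stalk P)))
          (theta_on_rho D s P (edge_target F) F
             ` carrier (theta_on_stalk D P (edge_target F)))),
      rho = theta_on_rho D s P\<rparr>)"

definition theta_out ::
  "'v::ab_group_add root_data \<Rightarrow> 'v weyl_elt \<Rightarrow> ('v, 'f::field) quotient_sheaf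
     \<Rightarrow> ('v, 'f) affine_sheaf" where
  "theta_out D s Q =
    (let q = (\<lambda>x. stalk Q (coset_pair D s x));
         joins = (\<lambda>E. edge_target E = edge_source E \<otimes>\<^bsub>affine_weyl_group D\<^esub> s);
         lq = (\<lambda>E. {label_scalar D (edge_label E) \<odot>\<^bsub>q (edge_source E)\<^esub> m
                     | m. m \<in> carrier (q (edge_source E))}) in
     \<lparr>stalk = q,
      edge_stalk = (\<lambda>E. if joins E
        then transport_module Elem un_Elem (graded_quotient_module (q (edge_source E)) (lq E))
        else edge_stalk Q (induced_edge D s E)),
      rho = (\<lambda>x E m. if joins E
        then Elem (lq E +>\<^bsub>q (edge_source E)\<^esub> m)
        else rho Q (coset_pair D s x) (induced_edge D s E) m)\<rparr>)"

definition theta ::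
  "'v::ab_group_add root_data \<Rightarrow> 'v weyl_elt \<Rightarrow> ('v, 'f::field) affine_sheaf
     \<Rightarrow> ('v, 'f) affine_sheaf" where
  "theta D s = theta_out D s \<circ> theta_on D s"

definition bott_samelson ::
  "'v::ab_group_add root_data \<Rightarrow> 'v weyl_elt list \<Rightarrow> ('v, 'f::field) affine_sheaf" where
  "bott_samelson D ss = fold (theta D) ss (unit_sheaf D)"


section \<open>The structure algebra and the combinatorial model\<close>

text \<open>Blanks are \<^const>\<open>None\<close>.\<close>

definition subsequences :: "'w list \<Rightarrow> 'w option list set" where
  "subsequences ss = {\<sigma>. list_all2 (\<lambda>o' s. o' = None \<or> o' = Some s) \<sigma> ss}"

definition ev :: "'v::ab_group_add root_data \<Rightarrow> 'v weyl_elt option list \<Rightarrow> 'v weyl_elt" where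
  "ev D \<sigma> = foldr (\<lambda>o' w. case o' of None \<Rightarrow> w | Some s \<Rightarrow> s \<otimes>\<^bsub>affine_weyl_group D\<^esub> w)
              \<sigma> \<one>\<^bsub>affine_weyl_group D\<^esub>"

definition subsequences_at ::
  "'v::ab_group_add root_data \<Rightarrow> 'v weyl_elt list \<Rightarrow> 'v weyl_elt
     \<Rightarrow> 'v weyl_elt option list set" where
  "subsequences_at D ss x = {\<sigma> \<in> subsequences ss. ev D \<sigma> = x}"

definition J :: "'v::ab_group_add root_data \<Rightarrow> 'v weyl_elt list \<Rightarrow> 'v weyl_elt set" where
  "J D ss = ev D ` subsequences ss"

definition structure_algebra ::
  "'v::ab_group_add root_data \<Rightarrow> 'v weyl_elt set
     \<Rightarrow> ('v weyl_elt \<Rightarrow> ('v, 'f::field) scalar) ring" where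
  "structure_algebra D I =
    \<lparr>carrier = {z \<in> (\<Pi>\<^sub>E x\<in>I. carrier (scalars D)).
       \<forall>\<alpha>\<in>affine_roots D. \<forall>x\<in>I.
         let y = affine_reflection D \<alpha> \<otimes>\<^bsub>affine_weyl_group D\<^esub> x in
         y \<in> I \<longrightarrow>
         z x \<ominus>\<^bsub>scalars D\<^esub> z y \<in> PIdl\<^bsub>scalars D\<^esub> (label_scalar D (lattice_bar D \<alpha>))},
     mult = (\<lambda>z z'. \<lambda>x\<in>I. z x \<otimes>\<^bsub>scalars D\<^esub> z' x),
     one = (\<lambda>x\<in>I. \<one>\<^bsub>scalars D\<^esub>),
     zero = (\<lambda>x\<in>I. \<zero>\<^bsub>scalars D\<^esub>),
     add = (\<lambda>z z'. \<lambda>x\<in>I. z x \<oplus>\<^bsub>scalars D\<^esub> z' x)\<rparr>"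

text \<open>The global sections of a sheaf supported in \<open>I\<close>, as a module over the structure algebra
  of \<open>I\<close>; outside \<open>I\<close> the components of a section vanish.\<close>

definition global_sections ::
  "'v::ab_group_add root_data \<Rightarrow> ('v, 'f::field) affine_sheaf \<Rightarrow> 'v weyl_elt set
     \<Rightarrow> ('v weyl_elt \<Rightarrow> ('v, 'f) scalar, 'v weyl_elt \<Rightarrow> ('v, 'f) stalk_elt) module" where
  "global_sections D M I =
    with_scalars
      (\<lambda>z m. \<lambda>x\<in>carrier (affine_weyl_group D).
         if x \<in> I then z x \<odot>\<^bsub>stalk M x\<^esub> m x else \<zero>\<^bsub>stalk M x\<^esub>)
      (section_module (affine_moment_graph D) M (carrier (affine_weyl_group D)))"

definition weight_section ::
  "'v::ab_group_add root_data \<Rightarrow> 'v \<times> rat \<Rightarrow> 'v weyl_elt \<Rightarrow> ('v, 'f::field) scalar" where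
  "weight_section D \<mu> x = label_scalar D (lattice_bar D (linear_action D x \<mu>))"

definition simple_affine_root_of ::
  "'v::ab_group_add root_data \<Rightarrow> 'v weyl_elt \<Rightarrow> 'v \<times> rat" where
  "simple_affine_root_of D s = (THE \<alpha>. \<alpha> \<in> simple_affine_roots D \<and> s = affine_reflection D \<alpha>)"

definition Delta ::
  "'w list \<Rightarrow> ('w option list \<Rightarrow> 'a) \<Rightarrow> 'w option list \<Rightarrow> 'a" where
  "Delta ss f = (\<lambda>\<sigma>\<in>subsequences ss. f (butlast \<sigma>))"

text \<open>The recursion runs over the reversed sequence, since it removes the last entry.\<close>

primrec X_reversed ::
  "'v::ab_group_add root_data \<Rightarrow> 'v weyl_elt list
     \<Rightarrow> ('v weyl_elt option list \<Rightarrow> ('v, 'f::field) scalar) set" where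
  "X_reversed D [] = (\<Pi>\<^sub>E \<sigma>\<in>subsequences []. carrier (scalars D))"
| "X_reversed D (s # rs) =
    {(\<lambda>\<sigma>\<in>subsequences (rev (s # rs)).
        Delta (rev (s # rs)) f \<sigma> \<oplus>\<^bsub>scalars D\<^esub>
        weight_section D (simple_affine_root_of D s) (ev D \<sigma>)
          \<otimes>\<^bsub>scalars D\<^esub> Delta (rev (s # rs)) g \<sigma>)
      | f g. f \<in> X_reversed D rs \<and> g \<in> X_reversed D rs}"

definition X_set ::
  "'v::ab_group_add root_data \<Rightarrow> 'v weyl_elt list
     \<Rightarrow> ('v weyl_elt option list \<Rightarrow> ('v, 'f::field) scalar) set" where
  "X_set D ss = X_reversed D (rev ss)"

definition X_module ::
  "'v::ab_group_add root_data \<Rightarrow> 'v weyl_elt list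
     \<Rightarrow> ('v weyl_elt \<Rightarrow> ('v, 'f::field) scalar,
         'v weyl_elt option list \<Rightarrow> ('v, 'f) scalar) module" where
  "X_module D ss =
    with_scalars
      (\<lambda>z f. \<lambda>\<sigma>\<in>subsequences ss. z (ev D \<sigma>) \<otimes>\<^bsub>scalars D\<^esub> f \<sigma>)
      (restrict_module (product_module (subsequences ss) (\<lambda>_. scalar_module D)) (X_set D ss))"

definition X_stalk ::
  "'v::ab_group_add root_data \<Rightarrow> 'v weyl_elt list \<Rightarrow> 'v weyl_elt
     \<Rightarrow> (('v, 'f::field) scalar, 'v weyl_elt option list \<Rightarrow> ('v, 'f) scalar) graded_module" where
  "X_stalk D ss x =
    restrict_module (product_module (subsequences_at D ss x) (\<lambda>_. scalar_module D))
      {restrict f (subsequences_at D ss x) | f. f \<in> X_set D ss}"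

definition X_costalk ::
  "'v::ab_group_add root_data \<Rightarrow> 'v weyl_elt list \<Rightarrow> 'v weyl_elt
     \<Rightarrow> (('v, 'f::field) scalar, 'v weyl_elt option list \<Rightarrow> ('v, 'f) scalar) graded_module" where
  "X_costalk D ss x =
    restrict_module (product_module (subsequences_at D ss x) (\<lambda>_. scalar_module D))
      {restrict f (subsequences_at D ss x) | f. f \<in> X_set D ss \<and>
         (\<forall>\<sigma>\<in>subsequences ss - subsequences_at D ss x. f \<sigma> = \<zero>\<^bsub>scalars D\<^esub>)}"

end

theory Submission
  imports Defs
begin

text \<open>The stalks of \<open>\<B>(\<s>)\<close> contain zero, and the maps \<open>\<rho>\<close> send it to zero; this passes
  through every translation functor. Hence \<open>m \<in> \<B>(\<s>)\<^sub>x\<close> extends by zero to a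
  global section, and conversely a global section vanishing off \<open>x\<close> has its value at \<open>x\<close> in \<open>\<B>(\<s>)\<^sub>x\<close>. Since
  \<open>\<phi>\<^sub>y\<close> is injective and \<open>\<phi>\<^sub>y 0 = 0\<close>, the isomorphism \<open>\<phi>\<close> matches these sections with the
  elements of \<open>\<X>(\<s>)\<close> that vanish off \<open>I(\<s>)\<^sub>x\<close>.

  Two facts about the affine setting enter. Simple reflections must be involutions in the affine
  Weyl group, for which the highest root has to exist. And \<open>c\<^sup>\<alpha>\<close> must take values in the
  scalars, for which the linear action of the affine Weyl group has to be well defined.\<close>

section \<open>The highest root\<close>

text \<open>Stalks arise as bare records, and \<open>module_iso\<close> asks only for a bijection
  compatible with sums and scalars. The laws for zero therefore have to be established by hand on
  both sides, and this shapes the proof. On the sheaf side they form the invariant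
  \<open>vanishing_at_zero\<close>. It passes through \<open>theta\<close> because either member of
  {x, xs} determines the same coset, which is where s^2 = 1 is used. On the model side, the image a
  of zero under \<open>\<phi>\<^sub>x y\<close> satisfies a = a + a, and a = 0 follows by
  cancellation inside the ring of scalars; this is why the values of c^alpha matter. Three objects,
  \<open>highest_root\<close>, \<open>linear_action\<close> and
  \<open>simple_affine_root_of\<close>, are definite descriptions, about which nothing can be said
  before existence and uniqueness are known. For the highest root this is the classical theorem on
  irreducible root systems, developed here from an invariant form on V*.\<close>

locale root_system =
  fixes D :: "'v::ab_group_add root_data"
  assumes root_system: "is_root_system D"
begin

sublocale V: vector_space "scl D"
  using root_system by (simp add: is_root_system_def)

abbreviation root_reflection :: "'v \<Rightarrow> 'v \<Rightarrow> 'v" where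
  "root_reflection \<alpha> \<mu> \<equiv> \<mu> - scl D (coroot D \<alpha> \<mu>) \<alpha>"

section \<open>Roots, reflections and Cartan integers\<close>

lemma finite_roots: "finite (roots D)"
  and zero_not_root: "0 \<notin> roots D"
  and span_roots: "V.span (roots D) = UNIV"
  using root_system by (auto simp: is_root_system_def)

lemma linear_coroot: "\<alpha> \<in> roots D \<Longrightarrow> Vector_Spaces.linear (scl D) (*) (coroot D \<alpha>)"
  and coroot_self: "\<alpha> \<in> roots D \<Longrightarrow> coroot D \<alpha> \<alpha> = 2"
  and image_root_reflection: "\<alpha> \<in> roots D \<Longrightarrow> root_reflection \<alpha> ` roots D = roots D"
  and coroot_integral: "\<alpha> \<in> roots D \<Longrightarrow> \<beta> \<in> roots D \<Longrightarrow> coroot D \<alpha> \<beta> \<in> \<int>"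
  using root_system by (auto simp: is_root_system_def)

lemma linear_module_hom: "Vector_Spaces.linear (scl D) (*) f \<Longrightarrow> module_hom (scl D) (*) f"
  for f :: "'v \<Rightarrow> rat"
  by (simp add: Vector_Spaces.linear_def)

lemmas linear_simps = module_hom.add[OF linear_module_hom] module_hom.diff[OF linear_module_hom]
  module_hom.scale[OF linear_module_hom] module_hom.neg[OF linear_module_hom]
  module_hom.zero[OF linear_module_hom] module_hom.sum[OF linear_module_hom]

lemma root_reflection_root: "\<alpha> \<in> roots D \<Longrightarrow> \<beta> \<in> roots D \<Longrightarrow> root_reflection \<alpha> \<beta> \<in> roots D"
  using image_root_reflection by blast

lemma uminus_root: "\<alpha> \<in> roots D \<Longrightarrow> - \<alpha> \<in> roots D"
  using root_reflection_root[of \<alpha> \<alpha>] V.scale_left_distrib[of 1 1 \<alpha>]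
  by (simp add: coroot_self)

text \<open>The canonical form on V*: invariant because reflections permute the roots, and
  nonnegative on the diagonal as a sum of squares. Living on V*, it applies directly to coroots and
  replaces the choice of an inner product on V.\<close>

definition dual_form :: "('v \<Rightarrow> rat) \<Rightarrow> ('v \<Rightarrow> rat) \<Rightarrow> rat" where
  "dual_form v w = (\<Sum>\<alpha>\<in>roots D. v \<alpha> * w \<alpha>)"

lemma dual_form_commute: "dual_form v w = dual_form w v"
  by (simp add: dual_form_def mult.commute)

text \<open>This is the invariance of the form under the reflection in \<open>\<alpha>\<close>: the coroot of
  \<open>\<alpha>\<close> changes sign under it.\<close>

lemma dual_form_coroot:
  assumes a: "\<alpha> \<in> roots D" and v: "Vector_Spaces.linear (scl D) (*) v"
  shows "2 * dual_form v (coroot D \<alpha>) = v \<alpha> * dual_form (coroot D \<alpha>) (coroot D \<alpha>)"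
proof -
  let ?c = "coroot D \<alpha>" and ?s = "root_reflection \<alpha>"
  note c = linear_coroot[OF a]
  have inj: "inj_on ?s (roots D)"
    using finite_roots image_root_reflection[OF a] by (simp add: eq_card_imp_inj_on)
  have "dual_form v ?c = (\<Sum>\<beta>\<in>?s ` roots D. v \<beta> * ?c \<beta>)"
    by (simp add: dual_form_def image_root_reflection[OF a])
  also have "\<dots> = (\<Sum>\<beta>\<in>roots D. v (?s \<beta>) * ?c (?s \<beta>))"
    by (simp add: sum.reindex[OF inj])
  also have "\<dots> = (\<Sum>\<beta>\<in>roots D. v \<alpha> * (?c \<beta> * ?c \<beta>) - v \<beta> * ?c \<beta>)"
  proof (intro sum.cong refl)
    fix \<beta>
    have eq: "v (?s \<beta>) = v \<beta> - ?c \<beta> * v \<alpha>" "?c (?s \<beta>) = - ?c \<beta>"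
      by (simp_all add: linear_simps[OF v] linear_simps[OF c] coroot_self[OF a])
    show "v (?s \<beta>) * ?c (?s \<beta>) = v \<alpha> * (?c \<beta> * ?c \<beta>) - v \<beta> * ?c \<beta>"
      unfolding eq by (simp add: algebra_simps)
  qed
  also have "\<dots> = v \<alpha> * dual_form ?c ?c - dual_form v ?c"
    by (simp add: sum_subtractf dual_form_def sum_distrib_left)
  finally show ?thesis by simp
qed

lemma dual_form_coroot_pos: "\<alpha> \<in> roots D \<Longrightarrow> dual_form (coroot D \<alpha>) (coroot D \<alpha>) > 0"
  unfolding dual_form_def
  by (rule sum_pos2[of _ \<alpha>]) (auto simp: finite_roots coroot_self)

text \<open>The usual quotient for Cartan integers, read in the dual root system; hence the norm in
  the denominator is that of the coroot of \<beta>. Since the numerator is symmetric in \<alpha> and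
  \<beta>, the two Cartan integers of a pair have the same sign.\<close>

lemma coroot_eq_dual_form:
  assumes "\<alpha> \<in> roots D" "\<beta> \<in> roots D"
  shows "coroot D \<alpha> \<beta> =
    2 * dual_form (coroot D \<alpha>) (coroot D \<beta>) / dual_form (coroot D \<beta>) (coroot D \<beta>)"
  using dual_form_coroot[OF assms(2) linear_coroot[OF assms(1)]] dual_form_coroot_pos[OF assms(2)]
  by (simp add: field_simps)

lemma coroot_pos_commute:
  assumes "\<alpha> \<in> roots D" "\<beta> \<in> roots D"
  shows "coroot D \<alpha> \<beta> > 0 \<longleftrightarrow> coroot D \<beta> \<alpha> > 0"
  using coroot_eq_dual_form[OF assms] coroot_eq_dual_form[OF assms(2,1)]
    dual_form_coroot_pos[OF assms(1)] dual_form_coroot_pos[OF assms(2)]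
  by (simp add: dual_form_commute[of "coroot D \<beta>" "coroot D \<alpha>"] zero_less_divide_iff)

lemma coroot_zero_commute:
  assumes "\<alpha> \<in> roots D" "\<beta> \<in> roots D"
  shows "coroot D \<alpha> \<beta> = 0 \<longleftrightarrow> coroot D \<beta> \<alpha> = 0"
  using coroot_eq_dual_form[OF assms] coroot_eq_dual_form[OF assms(2,1)]
    dual_form_coroot_pos[OF assms(1)] dual_form_coroot_pos[OF assms(2)]
  by (simp add: dual_form_commute[of "coroot D \<beta>" "coroot D \<alpha>"])

lemma coroot_nonneg_commute:
  assumes "\<alpha> \<in> roots D" "\<beta> \<in> roots D"
  shows "coroot D \<alpha> \<beta> \<ge> 0 \<longleftrightarrow> coroot D \<beta> \<alpha> \<ge> 0"
  using coroot_pos_commute[OF assms] coroot_zero_commute[OF assms] by (auto simp: le_less)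

lemma coroot_product_le:
  assumes "\<alpha> \<in> roots D" "\<beta> \<in> roots D"
  shows "coroot D \<alpha> \<beta> * coroot D \<beta> \<alpha> \<le> 4"
proof -
  let ?a = "coroot D \<alpha>" and ?b = "coroot D \<beta>"
  define x where "x = dual_form ?a ?b"
  define y where "y = dual_form ?b ?b"
  define z where "z = dual_form ?a ?a"
  have pos: "y > 0" "z > 0"
    using assms dual_form_coroot_pos by (auto simp: y_def z_def)
  \<comment> \<open>Cauchy-Schwarz: y a - x b is y times the component of a orthogonal to b, and its
    square norm is expanded.\<close>
  have "0 \<le> (\<Sum>\<gamma>\<in>roots D. (y * ?a \<gamma> - x * ?b \<gamma>)\<^sup>2)"
    by (intro sum_nonneg) simp
  also have "\<dots> = (\<Sum>\<gamma>\<in>roots D. y * y * (?a \<gamma> * ?a \<gamma>) - 2 * x * y * (?a \<gamma> * ?b \<gamma>)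
      + x * x * (?b \<gamma> * ?b \<gamma>))"
    by (intro sum.cong refl) (simp add: power2_eq_square algebra_simps)
  also have "\<dots> = y * y * z - 2 * x * y * x + x * x * y"
    by (simp add: sum.distrib sum_subtractf x_def y_def z_def dual_form_def
        sum_distrib_left[symmetric])
  also have "\<dots> = y * (y * z - x * x)"
    by (simp add: algebra_simps)
  finally have "x * x \<le> y * z"
    using pos by (simp add: zero_le_mult_iff)
  moreover have "coroot D \<alpha> \<beta> * coroot D \<beta> \<alpha> = 4 * (x * x) / (y * z)"
    using coroot_eq_dual_form[OF assms] coroot_eq_dual_form[OF assms(2,1)]
    by (simp add: dual_form_commute[of ?b ?a] x_def y_def z_def)
  ultimately show ?thesis
    using pos by (simp add: divide_le_eq)
qed

text \<open>The product of the two reflections translates \<open>\<alpha>\<close> by \<open>2 (\<alpha> - \<beta>)\<close>, so that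
  \<open>\<alpha> \<noteq> \<beta>\<close> would make the set of roots infinite.\<close>

lemma coroots_two_imp_eq:
  assumes a: "\<alpha> \<in> roots D" and b: "\<beta> \<in> roots D"
    and ab: "coroot D \<alpha> \<beta> = 2" "coroot D \<beta> \<alpha> = 2"
  shows "\<alpha> = \<beta>"
proof (rule ccontr)
  assume ne: "\<alpha> \<noteq> \<beta>"
  define \<delta> where "\<delta> = \<alpha> - \<beta>"
  note la = linear_simps[OF linear_coroot[OF a]] and lb = linear_simps[OF linear_coroot[OF b]]
  \<comment> \<open>Both reflections fix \<delta>, so the translation can be repeated
    indefinitely.\<close>
  have d: "coroot D \<alpha> \<delta> = 0" "coroot D \<beta> \<delta> = 0"
    by (simp_all add: \<delta>_def la lb ab coroot_self a b)
  have root: "\<alpha> + scl D (of_nat (2 * n)) \<delta> \<in> roots D" for n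
  proof (induction n)
    case 0
    show ?case using a by simp
  next
    case (Suc n)
    let ?\<gamma> = "\<alpha> + scl D (of_nat (2 * n)) \<delta>"
    have "root_reflection \<beta> ?\<gamma> = ?\<gamma> - scl D 2 \<beta>"
      by (simp add: lb d ab)
    moreover have "root_reflection \<alpha> (?\<gamma> - scl D 2 \<beta>) = ?\<gamma> - scl D 2 \<beta> + scl D 2 \<alpha>"
      by (simp add: la d ab coroot_self a)
    moreover have "\<dots> = \<alpha> + scl D (of_nat (2 * Suc n)) \<delta>"
      by (simp add: \<delta>_def algebra_simps V.scale_right_diff_distrib V.scale_left_distrib)
    ultimately show ?case
      using root_reflection_root[OF a] root_reflection_root[OF b Suc] by metis
  qed
  have "inj (\<lambda>n. \<alpha> + scl D (of_nat (2 * n)) \<delta>)"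
    using ne by (auto simp: inj_def \<delta>_def)
  moreover have "range (\<lambda>n. \<alpha> + scl D (of_nat (2 * n)) \<delta>) \<subseteq> roots D"
    using root by auto
  ultimately show False
    using finite_roots finite_subset finite_imageD infinite_UNIV_nat by blast
qed

text \<open>Both Cartan integers are positive with product at most 4, so one of them is 1 or both
  are 2. The latter would give \<alpha> = \<beta>. If one is 1, the corresponding reflection sends
  the other root to the difference up to sign.\<close>

lemma diff_root:
  assumes a: "\<alpha> \<in> roots D" and b: "\<beta> \<in> roots D" and ne: "\<alpha> \<noteq> \<beta>"
    and pos: "coroot D \<alpha> \<beta> > 0"
  shows "\<alpha> - \<beta> \<in> roots D"
proof -
  obtain m n where mn: "coroot D \<alpha> \<beta> = of_int m" "coroot D \<beta> \<alpha> = of_int n"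
    using coroot_integral[OF a b] coroot_integral[OF b a] by (auto elim!: Ints_cases)
  have mn_pos: "m > 0" "n > 0"
    using pos coroot_pos_commute[OF a b] mn by auto
  have "of_int (m * n) \<le> (of_int 4 :: rat)"
    using coroot_product_le[OF a b] mn by simp
  then have mn_le: "m * n \<le> 4"
    by (simp only: of_int_le_iff)
  have "m = 1 \<or> n = 1"
  proof (rule ccontr)
    assume "\<not> ?thesis"
    then have ge: "m \<ge> 2" "n \<ge> 2"
      using mn_pos by auto
    have "2 * n \<le> m * n" "m * 2 \<le> m * n"
      using ge by (intro mult_right_mono mult_left_mono; simp)+
    then have "m = 2" "n = 2"
      using mn_le ge by linarith+
    then show False
      using coroots_two_imp_eq[OF a b] mn ne by simp
  qed
  then show ?thesis
  proof
    assume "m = 1"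
    then have "\<beta> - \<alpha> \<in> roots D"
      using root_reflection_root[OF a b] mn by simp
    then show ?thesis
      using uminus_root by fastforce
  next
    assume "n = 1"
    then show ?thesis
      using root_reflection_root[OF b a] mn by simp
  qed
qed

end

section \<open>Coordinates with respect to the simple roots\<close>

locale simple_root_system = root_system D for D :: "'v::ab_group_add root_data" +
  assumes simple: "is_simple_system D"
begin

lemma simple_root: "\<beta> \<in> simple_roots D \<Longrightarrow> \<beta> \<in> roots D"
  and independent_simple: "V.independent (simple_roots D)"
  and root_sign: "\<alpha> \<in> roots D \<Longrightarrow> \<alpha> \<in> nonneg_combinations D \<or> - \<alpha> \<in> nonneg_combinations D"
  using simple by (auto simp: is_simple_system_def)

lemma finite_simple: "finite (simple_roots D)"
  using simple_root finite_roots by (meson finite_subset subsetI)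

lemma span_simple: "V.span (simple_roots D) = UNIV"
proof -
  have "nonneg_combinations D \<subseteq> V.span (simple_roots D)"
    unfolding nonneg_combinations_def by (auto intro: V.span_sum V.span_scale V.span_base)
  then have "roots D \<subseteq> V.span (simple_roots D)"
    using root_sign V.span_neg by (metis minus_minus subset_iff)
  then have "V.span (roots D) \<subseteq> V.span (simple_roots D)"
    by (simp add: V.span_minimal)
  then show ?thesis
    using span_roots by auto
qed

definition coord :: "'v \<Rightarrow> 'v \<Rightarrow> rat" where
  "coord = V.representation (simple_roots D)"

lemma coord_add: "coord (\<mu> + \<nu>) \<beta> = coord \<mu> \<beta> + coord \<nu> \<beta>"
  and coord_diff: "coord (\<mu> - \<nu>) \<beta> = coord \<mu> \<beta> - coord \<nu> \<beta>"
  and coord_minus: "coord (- \<mu>) \<beta> = - coord \<mu> \<beta>"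
  and coord_scale: "coord (scl D c \<mu>) \<beta> = c * coord \<mu> \<beta>"
  by (simp_all add: coord_def V.representation_add V.representation_diff V.representation_neg
      V.representation_scale independent_simple span_simple)

lemmas coord_simps = coord_add coord_diff coord_minus coord_scale

lemma coord_simple: "\<beta> \<in> simple_roots D \<Longrightarrow> coord \<beta> \<gamma> = (if \<gamma> = \<beta> then 1 else 0)"
  by (simp add: coord_def V.representation_basis independent_simple)

lemma sum_coord: "(\<Sum>\<beta>\<in>simple_roots D. scl D (coord \<mu> \<beta>) \<beta>) = \<mu>"
  unfolding coord_def
  by (rule V.sum_representation_eq) (simp_all add: independent_simple span_simple finite_simple)

lemma coord_eqI: "(\<And>\<beta>. \<beta> \<in> simple_roots D \<Longrightarrow> coord \<mu> \<beta> = coord \<nu> \<beta>) \<Longrightarrow> \<mu> = \<nu>"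
  using sum_coord[of \<mu>] sum_coord[of \<nu>] by (metis (no_types, lifting) sum.cong)

lemma linear_eq_sum_coord:
  assumes "Vector_Spaces.linear (scl D) (*) f"
  shows "f \<mu> = (\<Sum>\<beta>\<in>simple_roots D. coord \<mu> \<beta> * f \<beta>)"
proof -
  have "f \<mu> = f (\<Sum>\<beta>\<in>simple_roots D. scl D (coord \<mu> \<beta>) \<beta>)"
    by (simp only: sum_coord)
  then show ?thesis
    by (simp add: linear_simps[OF assms])
qed

lemma nonneg_combinations_iff:
  "\<mu> \<in> nonneg_combinations D \<longleftrightarrow> (\<forall>\<beta>\<in>simple_roots D. coord \<mu> \<beta> \<in> \<nat>)"
proof
  assume "\<mu> \<in> nonneg_combinations D"
  then obtain k where k: "\<mu> = (\<Sum>\<beta>\<in>simple_roots D. scl D (of_nat (k \<beta>)) \<beta>)"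
    by (auto simp: nonneg_combinations_def)
  have "coord \<mu> \<gamma> = of_nat (k \<gamma>)" if "\<gamma> \<in> simple_roots D" for \<gamma>
  proof -
    have "coord \<mu> \<gamma> = (\<Sum>\<beta>\<in>simple_roots D. coord (scl D (of_nat (k \<beta>)) \<beta>) \<gamma>)"
      unfolding k coord_def
      by (subst V.representation_sum) (simp_all add: independent_simple span_simple)
    also have "\<dots> = (\<Sum>\<beta>\<in>simple_roots D. if \<gamma> = \<beta> then of_nat (k \<beta>) else 0)"
      by (intro sum.cong refl) (simp add: coord_scale coord_simple)
    finally show ?thesis
      using that finite_simple by simp
  qed
  then show "\<forall>\<beta>\<in>simple_roots D. coord \<mu> \<beta> \<in> \<nat>"
    by simp
next
  assume "\<forall>\<beta>\<in>simple_roots D. coord \<mu> \<beta> \<in> \<nat>"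
  then have "\<forall>\<beta>\<in>simple_roots D. \<exists>k. coord \<mu> \<beta> = of_nat k"
    by (auto elim: Nats_cases)
  then obtain k where "\<And>\<beta>. \<beta> \<in> simple_roots D \<Longrightarrow> coord \<mu> \<beta> = of_nat (k \<beta>)"
    by metis
  then have "\<mu> = (\<Sum>\<beta>\<in>simple_roots D. scl D (of_nat (k \<beta>)) \<beta>)"
    using sum_coord[of \<mu>] by (metis (no_types, lifting) sum.cong)
  then show "\<mu> \<in> nonneg_combinations D"
    unfolding nonneg_combinations_def by blast
qed

lemma coord_nonneg:
  "\<mu> \<in> nonneg_combinations D \<Longrightarrow> \<beta> \<in> simple_roots D \<Longrightarrow> coord \<mu> \<beta> \<ge> 0"
  using nonneg_combinations_iff by (auto elim!: Nats_cases)

lemma nonneg_combinations_add: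
  "\<mu> \<in> nonneg_combinations D \<Longrightarrow> \<nu> \<in> nonneg_combinations D \<Longrightarrow> \<mu> + \<nu> \<in> nonneg_combinations D"
  by (simp add: nonneg_combinations_iff coord_add)

text \<open>The coordinates of a root share one sign, so a single positive coordinate
  decides.\<close>

lemma root_nonneg_if_coord_pos:
  assumes "\<alpha> \<in> roots D" "\<beta> \<in> simple_roots D" "coord \<alpha> \<beta> > 0"
  shows "\<alpha> \<in> nonneg_combinations D"
  using root_sign[OF assms(1)] coord_nonneg[OF _ assms(2), of "- \<alpha>"] assms(3)
  by (auto simp: coord_minus)

text \<open>The reflection of \<gamma> in \<beta> keeps coordinate 1 at \<gamma>, so it is a
  positive root; its coordinate at \<beta> is the negated Cartan integer.\<close>

lemma coroot_simple_nonpos: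
  assumes b: "\<beta> \<in> simple_roots D" and g: "\<gamma> \<in> simple_roots D" and ne: "\<beta> \<noteq> \<gamma>"
  shows "coroot D \<beta> \<gamma> \<le> 0"
proof -
  let ?\<alpha> = "root_reflection \<beta> \<gamma>"
  have "?\<alpha> \<in> roots D"
    using b g simple_root root_reflection_root by blast
  moreover have "coord ?\<alpha> \<gamma> = 1" "coord ?\<alpha> \<beta> = - coroot D \<beta> \<gamma>"
    using b g ne by (simp_all add: coord_simps coord_simple)
  ultimately show ?thesis
    using root_nonneg_if_coord_pos[OF _ g, of ?\<alpha>] coord_nonneg[OF _ b, of ?\<alpha>] by simp
qed

definition height :: "'v \<Rightarrow> rat" where
  "height \<mu> = (\<Sum>\<beta>\<in>simple_roots D. coord \<mu> \<beta>)"

lemma height_diff: "height (\<mu> - \<nu>) = height \<mu> - height \<nu>"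
  by (simp add: height_def coord_diff sum_subtractf)

lemma height_pos:
  assumes "\<mu> \<in> nonneg_combinations D" "\<mu> \<noteq> 0"
  shows "height \<mu> > 0"
proof -
  obtain \<beta> where b: "\<beta> \<in> simple_roots D" "coord \<mu> \<beta> \<noteq> 0"
    using coord_eqI[of \<mu> 0] assms(2) coord_scale[of 0 0] by (metis mult_zero_left V.scale_zero_right)
  then have "coord \<mu> \<beta> > 0"
    using coord_nonneg[OF assms(1)] by (simp add: order_less_le)
  then show ?thesis
    unfolding height_def
    using b coord_nonneg[OF assms(1)] by (intro sum_pos2[of _ \<beta>]) (auto simp: finite_simple)
qed

text \<open>Expand 2 = \<open>coroot D \<alpha> \<alpha>\<close> in the coordinates of \<alpha>:
  some summand is positive.\<close>

lemma exists_simple_coroot_pos: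
  assumes a: "\<alpha> \<in> roots D" "\<alpha> \<in> nonneg_combinations D"
  obtains \<beta> where "\<beta> \<in> simple_roots D" "coord \<alpha> \<beta> > 0" "coroot D \<beta> \<alpha> > 0"
proof -
  have "(\<Sum>\<beta>\<in>simple_roots D. coord \<alpha> \<beta> * coroot D \<alpha> \<beta>) > 0"
    using linear_eq_sum_coord[OF linear_coroot[OF a(1)], of \<alpha>] coroot_self[OF a(1)] by simp
  then obtain \<beta> where b: "\<beta> \<in> simple_roots D" "coord \<alpha> \<beta> * coroot D \<alpha> \<beta> > 0"
    by (meson not_less sum_nonpos)
  then have "coord \<alpha> \<beta> > 0" "coroot D \<alpha> \<beta> > 0"
    using coord_nonneg[OF a(2) b(1)] by (auto simp: zero_less_mult_iff)
  then show ?thesis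
    using that b(1) coroot_pos_commute[OF a(1) simple_root[OF b(1)]] by blast
qed

text \<open>A positive root of minimal height among those with non-zero coordinates in both parts would be
  lowered by a simple reflection, staying in this set.\<close>

lemma root_supported_on_orthogonal_part:
  assumes part: "simple_roots D = A \<union> B" "A \<inter> B = {}"
    and orth: "\<And>a b. a \<in> A \<Longrightarrow> b \<in> B \<Longrightarrow> coroot D b a = 0"
    and root: "\<alpha> \<in> roots D"
  shows "(\<forall>a\<in>A. coord \<alpha> a = 0) \<or> (\<forall>b\<in>B. coord \<alpha> b = 0)"
proof -
  define M where "M = {\<alpha> \<in> roots D. \<alpha> \<in> nonneg_combinations D \<and>
    (\<exists>a\<in>A. coord \<alpha> a \<noteq> 0) \<and> (\<exists>b\<in>B. coord \<alpha> b \<noteq> 0)}"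
  \<comment> \<open>A' and B' are A and B in either order, because the simple root that lowers \<mu>
    may lie in either part.\<close>
  have lower: False
    if \<mu>: "\<mu> \<in> M" and min: "\<And>\<nu>. \<nu> \<in> M \<Longrightarrow> height \<mu> \<le> height \<nu>"
      and \<beta>: "\<beta> \<in> A'" "coord \<mu> \<beta> > 0" "coroot D \<beta> \<mu> > 0"
      and part': "simple_roots D = A' \<union> B'" "A' \<inter> B' = {}" "{A', B'} = {A, B}"
      and orth': "\<And>a b. a \<in> A' \<Longrightarrow> b \<in> B' \<Longrightarrow> coroot D a b = 0" for \<mu> \<beta> A' B'
  proof -
    let ?c = "coroot D \<beta> \<mu>"
    define \<nu> where "\<nu> = root_reflection \<beta> \<mu>"
    have M_iff: "\<alpha> \<in> M \<longleftrightarrow> \<alpha> \<in> roots D \<and> \<alpha> \<in> nonneg_combinations D \<and>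
        (\<exists>a\<in>A'. coord \<alpha> a \<noteq> 0) \<and> (\<exists>b\<in>B'. coord \<alpha> b \<noteq> 0)" for \<alpha>
      using part'(3) unfolding M_def by (auto simp: doubleton_eq_iff)
    have bs: "\<beta> \<in> simple_roots D"
      using \<beta> part' by auto
    have root_\<mu>: "\<mu> \<in> roots D" and pos_\<mu>: "\<mu> \<in> nonneg_combinations D"
      using \<mu> by (auto simp: M_def)
    have root_\<nu>: "\<nu> \<in> roots D"
      using root_reflection_root simple_root bs root_\<mu> by (simp add: \<nu>_def)
    have cn: "coord \<nu> \<gamma> = coord \<mu> \<gamma> - (if \<gamma> = \<beta> then ?c else 0)" for \<gamma>
      by (simp add: \<nu>_def coord_simps coord_simple[OF bs])
    obtain b where b: "b \<in> B'" "coord \<mu> b \<noteq> 0"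
      using \<mu> M_iff by blast
    then have b': "b \<in> simple_roots D" "b \<noteq> \<beta>"
      using part' \<beta> by auto
    then have "coord \<nu> b > 0"
      using cn b coord_nonneg[OF pos_\<mu>, of b] by auto
    then have pos_\<nu>: "\<nu> \<in> nonneg_combinations D"
      using root_nonneg_if_coord_pos root_\<nu> b' by blast
    have "height \<nu> = height \<mu> - ?c"
      unfolding height_def using bs by (simp add: cn sum_subtractf finite_simple)
    then have "\<nu> \<notin> M"
      using min[of \<nu>] \<beta> by auto
    then have zero: "coord \<nu> a = 0" if "a \<in> A'" for a
      using that M_iff root_\<nu> pos_\<nu> \<open>coord \<nu> b > 0\<close> b by force
    have "?c = (\<Sum>\<gamma>\<in>simple_roots D. coord \<mu> \<gamma> * coroot D \<beta> \<gamma>)"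
      using linear_eq_sum_coord linear_coroot simple_root bs by blast
    also have "\<dots> = (\<Sum>\<gamma>\<in>{\<beta>}. coord \<mu> \<gamma> * coroot D \<beta> \<gamma>)"
    proof (rule sum.mono_neutral_right)
      show "\<forall>\<gamma>\<in>simple_roots D - {\<beta>}. coord \<mu> \<gamma> * coroot D \<beta> \<gamma> = 0"
      proof
        fix \<gamma> assume \<gamma>: "\<gamma> \<in> simple_roots D - {\<beta>}"
        show "coord \<mu> \<gamma> * coroot D \<beta> \<gamma> = 0"
        proof (cases "\<gamma> \<in> A'")
          case True
          then show ?thesis using zero[OF True] cn[of \<gamma>] \<gamma> by simp
        next
          case False
          then show ?thesis using orth'[OF \<beta>(1), of \<gamma>] part'(1) \<gamma> by simp
        qed
      qed
    qed (use finite_simple bs in auto)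
    also have "\<dots> = 2 * ?c"
      using zero[OF \<beta>(1)] cn[of \<beta>] coroot_self[OF simple_root[OF bs]] by simp
    finally show False
      using \<beta> by simp
  qed
  have orth_sym: "coroot D a b = 0" if "a \<in> A" "b \<in> B" for a b
    using orth[OF that] coroot_zero_commute simple_root that part(1) by blast
  have "M = {}"
  proof (rule ccontr)
    assume ne: "M \<noteq> {}"
    have "finite M"
      using finite_roots by (simp add: M_def)
    then obtain \<mu> where \<mu>: "\<mu> \<in> M" and min: "\<And>\<nu>. \<nu> \<in> M \<Longrightarrow> height \<mu> \<le> height \<nu>"
      using ne ex_min_if_finite[of "height ` M"] by (auto simp: not_less)
    obtain \<beta> where \<beta>: "\<beta> \<in> simple_roots D" "coord \<mu> \<beta> > 0" "coroot D \<beta> \<mu> > 0"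
      using exists_simple_coroot_pos \<mu> unfolding M_def by blast
    show False
    proof (cases "\<beta> \<in> A")
      case True
      show False
        by (rule lower[OF \<mu> min True \<beta>(2,3), of B]) (use part orth_sym in auto)
    next
      case False
      then have "\<beta> \<in> B" using \<beta> part by auto
      show False
        by (rule lower[OF \<mu> min \<open>\<beta> \<in> B\<close> \<beta>(2,3), of A]) (use part orth in auto)
    qed
  qed
  then have "\<alpha> \<notin> M" "- \<alpha> \<notin> M"
    by auto
  then show ?thesis
    using root uminus_root[OF root] root_sign[OF root] by (auto simp: M_def coord_minus)
qed

section \<open>Maximal roots in the root order, and the highest root\<close>

definition is_maximal_root :: "'v \<Rightarrow> bool" where
  "is_maximal_root \<theta> \<longleftrightarrow>
    \<theta> \<in> roots D \<and> (\<forall>\<gamma>\<in>roots D. \<gamma> - \<theta> \<in> nonneg_combinations D \<longrightarrow> \<gamma> = \<theta>)"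

text \<open>A negative pairing would make the reflection of \<theta> in \<beta> a root strictly
  above \<theta>.\<close>

lemma maximal_root_dominant:
  assumes "is_maximal_root \<theta>" "\<beta> \<in> simple_roots D"
  shows "coroot D \<beta> \<theta> \<ge> 0"
proof (rule ccontr)
  assume neg: "\<not> ?thesis"
  have \<theta>: "\<theta> \<in> roots D"
    using assms(1) by (simp add: is_maximal_root_def)
  have b: "\<beta> \<in> roots D"
    using assms(2) simple_root by blast
  obtain m where m: "coroot D \<beta> \<theta> = of_int m"
    using coroot_integral[OF b \<theta>] by (auto elim: Ints_cases)
  then have "- coroot D \<beta> \<theta> = of_nat (nat (- m))"
    using neg by simp
  then have "- coroot D \<beta> \<theta> \<in> \<nat>"
    by simp
  then have "root_reflection \<beta> \<theta> - \<theta> \<in> nonneg_combinations D"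
    using assms(2) by (simp add: nonneg_combinations_iff coord_simps coord_simple)
  then have "root_reflection \<beta> \<theta> = \<theta>"
    using assms(1) root_reflection_root[OF b \<theta>] unfolding is_maximal_root_def by blast
  then show False
    using neg b zero_not_root by auto
qed

text \<open>A negative root lies strictly below its opposite.\<close>

lemma maximal_root_nonneg:
  assumes "is_maximal_root \<theta>"
  shows "\<theta> \<in> nonneg_combinations D"
proof (rule ccontr)
  assume *: "\<theta> \<notin> nonneg_combinations D"
  have \<theta>: "\<theta> \<in> roots D"
    using assms by (simp add: is_maximal_root_def)
  then have neg: "- \<theta> \<in> nonneg_combinations D"
    using * root_sign by blast
  then have "- \<theta> - \<theta> \<in> nonneg_combinations D"
    using nonneg_combinations_add[of "- \<theta>" "- \<theta>"] by simp
  then have "- \<theta> = \<theta>"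
    using assms uminus_root[OF \<theta>] unfolding is_maximal_root_def by blast
  with neg * show False
    by simp
qed

text \<open>Let B be the simple roots missing from \<theta> and A the others. For b in B, dominance
  makes the pairing of \<theta> with the coroot of b nonnegative, while each of its summands is
  nonpositive. So all summands vanish and A is orthogonal to B. Every root is then supported on one
  of the two parts, which splits the root system and contradicts irreducibility.\<close>

lemma maximal_root_coord_pos:
  assumes irr: "is_irreducible D" and max: "is_maximal_root \<theta>" and \<beta>: "\<beta> \<in> simple_roots D"
  shows "coord \<theta> \<beta> > 0"
proof (rule ccontr)
  assume neg: "\<not> ?thesis"
  define A where "A = {\<beta> \<in> simple_roots D. coord \<theta> \<beta> > 0}"
  define B where "B = {\<beta> \<in> simple_roots D. coord \<theta> \<beta> = 0}"
  have \<theta>: "\<theta> \<in> roots D" and pos: "\<theta> \<in> nonneg_combinations D"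
    using max maximal_root_nonneg by (auto simp: is_maximal_root_def)
  have part: "simple_roots D = A \<union> B" "A \<inter> B = {}"
    using coord_nonneg[OF pos] by (auto simp: A_def B_def order_less_le)
  have "\<beta> \<in> B"
    using coord_nonneg[OF pos \<beta>] neg \<beta> by (simp add: B_def)
  obtain \<alpha> where "\<alpha> \<in> A"
    using exists_simple_coroot_pos[OF \<theta> pos] by (auto simp: A_def)
  have orth: "coroot D b a = 0" if ab: "a \<in> A" "b \<in> B" for a b
  proof -
    have b: "b \<in> simple_roots D" and a: "a \<in> simple_roots D"
      using ab part by auto
    have nonpos: "coord \<theta> \<gamma> * coroot D b \<gamma> \<le> 0" if "\<gamma> \<in> simple_roots D" for \<gamma>
    proof (cases "\<gamma> = b")
      case True
      then show ?thesis using ab by (simp add: B_def)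
    next
      case False
      then show ?thesis
        using coroot_simple_nonpos[OF b that] coord_nonneg[OF pos that]
        by (simp add: mult_nonneg_nonpos)
    qed
    have "(\<Sum>\<gamma>\<in>simple_roots D. coord \<theta> \<gamma> * coroot D b \<gamma>) \<ge> 0"
      using maximal_root_dominant[OF max b] linear_eq_sum_coord[OF linear_coroot[OF simple_root[OF b]]]
      by metis
    moreover have "(\<Sum>\<gamma>\<in>simple_roots D. - (coord \<theta> \<gamma> * coroot D b \<gamma>)) \<ge> 0"
      by (rule sum_nonneg) (use nonpos in auto)
    ultimately have "(\<Sum>\<gamma>\<in>simple_roots D. - (coord \<theta> \<gamma> * coroot D b \<gamma>)) = 0"
      by (simp add: sum_negf)
    then have "- (coord \<theta> a * coroot D b a) = 0"
      using sum_nonneg_eq_0_iff[OF finite_simple, of "\<lambda>\<gamma>. - (coord \<theta> \<gamma> * coroot D b \<gamma>)"] nonpos a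
      by simp
    then show ?thesis
      using ab by (simp add: A_def)
  qed
  have orth': "coroot D a b = 0" if "a \<in> A" "b \<in> B" for a b
    using orth[OF that] coroot_zero_commute simple_root that part(1) by blast
  define RA where "RA = {\<alpha> \<in> roots D. \<forall>b\<in>B. coord \<alpha> b = 0}"
  define RB where "RB = {\<alpha> \<in> roots D. \<forall>a\<in>A. coord \<alpha> a = 0}"
  have "RA \<union> RB = roots D"
    using root_supported_on_orthogonal_part[OF part orth] by (auto simp: RA_def RB_def)
  moreover have "RA \<inter> RB = {}"
  proof -
    have "\<gamma> = 0" if "\<gamma> \<in> RA \<inter> RB" for \<gamma>
      using that part coord_scale[of 0 0] by (intro coord_eqI) (auto simp: RA_def RB_def)
    then show ?thesis
      using zero_not_root by (auto simp: RA_def)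
  qed
  moreover have "\<alpha> \<in> RA" "\<beta> \<in> RB"
    using \<open>\<alpha> \<in> A\<close> \<open>\<beta> \<in> B\<close> part simple_root by (auto simp: RA_def RB_def coord_simple)
  then have "RA \<noteq> {}" "RB \<noteq> {}"
    by auto
  ultimately obtain \<mu> \<nu> where \<mu>: "\<mu> \<in> RA" and \<nu>: "\<nu> \<in> RB" and ne: "coroot D \<nu> \<mu> \<noteq> 0"
    using irr unfolding is_irreducible_def by blast
  have root: "\<mu> \<in> roots D" "\<nu> \<in> roots D"
    using \<mu> \<nu> by (auto simp: RA_def RB_def)
  \<comment> \<open>\<open>coroot\<close> is linear only in its second argument. So \<nu> is
    expanded there first, the vanishing is swapped by symmetry, and then \<mu> is expanded in the
    same slot.\<close>
  have "coroot D a \<nu> = 0" if "a \<in> A" for a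
  proof -
    have "coroot D a \<nu> = (\<Sum>\<gamma>\<in>simple_roots D. coord \<nu> \<gamma> * coroot D a \<gamma>)"
      using linear_eq_sum_coord linear_coroot simple_root that part by blast
    also have "\<dots> = 0"
      using part \<nu> orth'[OF that] by (intro sum.neutral) (auto simp: RB_def)
    finally show ?thesis .
  qed
  then have *: "coroot D \<nu> a = 0" if "a \<in> A" for a
    using coroot_zero_commute root simple_root that part by blast
  have "coroot D \<nu> \<mu> = (\<Sum>\<gamma>\<in>simple_roots D. coord \<mu> \<gamma> * coroot D \<nu> \<gamma>)"
    using linear_eq_sum_coord linear_coroot root by blast
  also have "\<dots> = 0"
    using part \<mu> * by (intro sum.neutral) (auto simp: RA_def)
  finally show False
    using ne by simp
qed

text \<open>Full support of \<theta>' and dominance of \<theta> make the Cartan integer of two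
  distinct maximal roots positive. Their difference is then a root, hence positive or negative, so
  one lies above the other, against maximality.\<close>

lemma maximal_root_unique:
  assumes irr: "is_irreducible D" and \<theta>: "is_maximal_root \<theta>" and \<theta>': "is_maximal_root \<theta>'"
  shows "\<theta> = \<theta>'"
proof (rule ccontr)
  assume ne: "\<theta> \<noteq> \<theta>'"
  have root: "\<theta> \<in> roots D" "\<theta>' \<in> roots D"
    using \<theta> \<theta>' by (auto simp: is_maximal_root_def)
  obtain \<beta> where \<beta>: "\<beta> \<in> simple_roots D" "coroot D \<beta> \<theta> > 0"
    using exists_simple_coroot_pos[OF root(1) maximal_root_nonneg[OF \<theta>]] by blast
  have "coroot D \<theta> \<theta>' = (\<Sum>\<gamma>\<in>simple_roots D. coord \<theta>' \<gamma> * coroot D \<theta> \<gamma>)"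
    using linear_eq_sum_coord linear_coroot root by blast
  also have "\<dots> > 0"
  proof (rule sum_pos2[OF finite_simple \<beta>(1)])
    show "coord \<theta>' \<beta> * coroot D \<theta> \<beta> > 0"
      using maximal_root_coord_pos[OF irr \<theta>' \<beta>(1)]
        coroot_pos_commute[OF root(1) simple_root[OF \<beta>(1)]] \<beta>(2) by simp
    show "coord \<theta>' \<gamma> * coroot D \<theta> \<gamma> \<ge> 0" if "\<gamma> \<in> simple_roots D" for \<gamma>
      using maximal_root_coord_pos[OF irr \<theta>' that] maximal_root_dominant[OF \<theta> that]
        coroot_nonneg_commute[OF root(1) simple_root[OF that]] by simp
  qed
  finally have diff: "\<theta> - \<theta>' \<in> roots D"
    using diff_root root ne by blast
  then have "\<theta> - \<theta>' \<in> nonneg_combinations D \<or> \<theta>' - \<theta> \<in> nonneg_combinations D"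
    using root_sign[OF diff] by simp
  then show False
    using \<theta> \<theta>' root ne unfolding is_maximal_root_def by metis
qed

text \<open>Because S is closed upwards, an element of greatest height in S is maximal among all
  roots, not only within S.\<close>

lemma exists_maximal_root_in:
  assumes "S \<subseteq> roots D" "S \<noteq> {}"
    and up: "\<And>\<mu> \<nu>. \<mu> \<in> S \<Longrightarrow> \<nu> \<in> roots D \<Longrightarrow> \<nu> - \<mu> \<in> nonneg_combinations D \<Longrightarrow> \<nu> \<in> S"
  obtains \<theta> where "\<theta> \<in> S" "is_maximal_root \<theta>"
proof -
  have "finite S"
    using assms(1) finite_roots finite_subset by blast
  then have "Max (height ` S) \<in> height ` S"
    using assms(2) by simp
  then obtain \<theta> where \<theta>: "\<theta> \<in> S" "Max (height ` S) = height \<theta>"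
    by auto
  have max: "height \<nu> \<le> height \<theta>" if "\<nu> \<in> S" for \<nu>
    using that \<open>finite S\<close> unfolding \<theta>(2)[symmetric] by simp
  have "\<gamma> = \<theta>" if g: "\<gamma> \<in> roots D" "\<gamma> - \<theta> \<in> nonneg_combinations D" for \<gamma>
  proof (rule ccontr)
    assume "\<gamma> \<noteq> \<theta>"
    then have "height (\<gamma> - \<theta>) > 0"
      using height_pos g by simp
    then show False
      using max[OF up[OF \<theta>(1) g]] by (simp add: height_diff)
  qed
  then have "is_maximal_root \<theta>"
    using \<theta> assms(1) by (auto simp: is_maximal_root_def)
  then show ?thesis
    using that \<theta> by blast
qed

text \<open>The roots not below a maximal root \<theta> are closed upwards. If there were any, this
  set would contain a maximal root, which is \<theta> by uniqueness, although \<theta> is below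
  itself. So \<theta> lies above every root and meets the description of
  \<open>highest_root\<close>.\<close>

lemma highest_root_root:
  assumes irr: "is_irreducible D"
  shows "highest_root D \<in> roots D"
proof -
  have "roots D \<noteq> {}"
    using irr by (simp add: is_irreducible_def)
  then obtain \<theta> where \<theta>: "is_maximal_root \<theta>"
    using exists_maximal_root_in[of "roots D"] by blast
  have above: "\<theta> - \<alpha> \<in> nonneg_combinations D" if "\<alpha> \<in> roots D" for \<alpha>
  proof (rule ccontr)
    assume neg: "\<theta> - \<alpha> \<notin> nonneg_combinations D"
    let ?S = "{\<alpha> \<in> roots D. \<theta> - \<alpha> \<notin> nonneg_combinations D}"
    have up: "\<nu> \<in> ?S"
      if "\<mu> \<in> ?S" "\<nu> \<in> roots D" "\<nu> - \<mu> \<in> nonneg_combinations D" for \<mu> \<nu>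
      using that nonneg_combinations_add[of "\<theta> - \<nu>" "\<nu> - \<mu>"] by auto
    have S: "?S \<subseteq> roots D" "?S \<noteq> {}"
      using \<open>\<alpha> \<in> roots D\<close> neg by auto
    obtain \<mu> where \<mu>: "\<mu> \<in> ?S" "is_maximal_root \<mu>"
      by (rule exists_maximal_root_in[OF S up])
    then have "\<mu> = \<theta>"
      using maximal_root_unique[OF irr _ \<theta>] by blast
    then show False
      using \<mu> coord_scale[of 0 0] by (simp add: nonneg_combinations_iff)
  qed
  have "highest_root D = \<theta>"
    unfolding highest_root_def
  proof (rule the_equality)
    show "\<theta> \<in> roots D \<and> (\<forall>\<alpha>\<in>roots D. \<theta> - \<alpha> \<in> nonneg_combinations D)"
      using \<theta> above by (simp add: is_maximal_root_def)
    fix \<theta>'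
    assume "\<theta>' \<in> roots D \<and> (\<forall>\<alpha>\<in>roots D. \<theta>' - \<alpha> \<in> nonneg_combinations D)"
    then show "\<theta>' = \<theta>"
      using \<theta> unfolding is_maximal_root_def by blast
  qed
  then show ?thesis
    using \<theta> by (simp add: is_maximal_root_def)
qed

end

section \<open>The affine Weyl group\<close>

text \<open>Gives irreflexivity, so that the two ends of an edge are different.\<close>

lemma bruhat_less_length:
  "bruhat_less W S u w \<Longrightarrow> coxeter_length W S u < coxeter_length W S w"
  unfolding bruhat_less_def by (induction rule: tranclp_induct) (auto simp: bruhat_step_def)

lemma carrier_affine_weyl_group:
    "carrier (affine_weyl_group D) =
      generate (BijGroup (dual_space D)) (affine_reflection D ` affine_roots D)"
  and mult_affine_weyl_group: "mult (affine_weyl_group D) = mult (BijGroup (dual_space D))"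
  and one_affine_weyl_group: "one (affine_weyl_group D) = one (BijGroup (dual_space D))"
  by (simp_all add: affine_weyl_group_def)

section \<open>The affine Weyl group acting on V* and its linear counterpart on affine
  functions\<close>

context root_system
begin

abbreviation W :: "'v weyl_elt monoid" where
  "W \<equiv> affine_weyl_group D"

lemma dual_space_iff: "v \<in> dual_space D \<longleftrightarrow> Vector_Spaces.linear (scl D) (*) v"
  by (simp add: dual_space_def)

lemma vector_space_rat: "vector_space ((*) :: rat \<Rightarrow> rat \<Rightarrow> rat)"
  by unfold_locales (auto simp: algebra_simps)

lemma dual_spaceI:
  assumes "\<And>x y. v (x + y) = v x + v y" "\<And>c x. v (scl D c x) = c * v x"
  shows "v \<in> dual_space D"
  unfolding dual_space_iff Vector_Spaces.linear_iff
  using V.vector_space_axioms vector_space_rat assms by auto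

lemma zero_dual_space: "(\<lambda>_. 0) \<in> dual_space D"
  by (rule dual_spaceI) simp_all

lemma affine_reflection_apply:
  "v \<in> dual_space D \<Longrightarrow>
    affine_reflection D \<gamma> v = (\<lambda>\<mu>. v \<mu> - (v (fst \<gamma>) + snd \<gamma>) * coroot D (fst \<gamma>) \<mu>)"
  by (simp add: affine_reflection_def)

lemma affine_reflection_dual_space:
  assumes "fst \<gamma> \<in> roots D" "v \<in> dual_space D"
  shows "affine_reflection D \<gamma> v \<in> dual_space D"
proof -
  note v = linear_simps[OF assms(2)[unfolded dual_space_iff]]
  note c = linear_simps[OF linear_coroot[OF assms(1)]]
  show ?thesis
    unfolding affine_reflection_apply[OF assms(2)]
    by (rule dual_spaceI) (simp_all add: v c ring_distribs mult_ac)
qed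

lemma affine_reflection_involutive:
  assumes "fst \<gamma> \<in> roots D" "v \<in> dual_space D"
  shows "affine_reflection D \<gamma> (affine_reflection D \<gamma> v) = v"
  unfolding affine_reflection_apply[OF affine_reflection_dual_space[OF assms]]
  unfolding affine_reflection_apply[OF assms(2)] coroot_self[OF assms(1)]
  by (simp add: ring_distribs fun_eq_iff)

lemma affine_reflection_Bij:
  assumes "fst \<gamma> \<in> roots D"
  shows "affine_reflection D \<gamma> \<in> Bij (dual_space D)"
proof -
  have "bij_betw (affine_reflection D \<gamma>) (dual_space D) (dual_space D)"
    by (rule bij_betw_byWitness[where f' = "affine_reflection D \<gamma>"])
      (auto simp: affine_reflection_involutive assms affine_reflection_dual_space)
  then show ?thesis
    by (simp add: Bij_def affine_reflection_def)
qed

lemma affine_reflections_subset: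
  "affine_reflection D ` affine_roots D \<subseteq> carrier (BijGroup (dual_space D))"
  by (auto simp: BijGroup_def affine_roots_def intro!: affine_reflection_Bij)

sublocale W: group W
proof -
  interpret B: group "BijGroup (dual_space D)"
    by (rule group_BijGroup)
  show "group W"
    unfolding affine_weyl_group_def
    by (rule B.subgroup_imp_group[OF B.generate_is_subgroup[OF affine_reflections_subset]])
qed

lemma affine_weyl_group_Bij: "w \<in> carrier W \<Longrightarrow> w \<in> Bij (dual_space D)"
proof -
  assume "w \<in> carrier W"
  then have "w \<in> carrier (BijGroup (dual_space D))"
    unfolding carrier_affine_weyl_group
    by (rule group.generate_in_carrier[OF group_BijGroup affine_reflections_subset])
  then show ?thesis
    by (simp add: BijGroup_def)
qed

lemma affine_reflection_closed: "\<gamma> \<in> affine_roots D \<Longrightarrow> affine_reflection D \<gamma> \<in> carrier W"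
  by (auto simp: carrier_affine_weyl_group intro: generate.incl)

lemma mult_apply:
  "g \<in> carrier W \<Longrightarrow> w \<in> carrier W \<Longrightarrow> v \<in> dual_space D \<Longrightarrow> (g \<otimes>\<^bsub>W\<^esub> w) v = g (w v)"
  using affine_weyl_group_Bij
  by (simp add: mult_affine_weyl_group BijGroup_def compose_def)

lemma one_apply: "v \<in> dual_space D \<Longrightarrow> \<one>\<^bsub>W\<^esub> v = v"
  by (simp add: one_affine_weyl_group BijGroup_def)

lemma weyl_elt_eqI:
  assumes "g \<in> carrier W" "w \<in> carrier W" "\<And>v. v \<in> dual_space D \<Longrightarrow> g v = w v"
  shows "g = w"
  by (rule extensionalityI[OF Bij_imp_extensional Bij_imp_extensional])
    (use assms affine_weyl_group_Bij in auto)

lemma weyl_elt_image: "w \<in> carrier W \<Longrightarrow> w ` dual_space D = dual_space D"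
  using affine_weyl_group_Bij by (auto simp: Bij_def bij_betw_def)

lemma affine_reflection_square:
  assumes "\<gamma> \<in> affine_roots D"
  shows "affine_reflection D \<gamma> \<otimes>\<^bsub>W\<^esub> affine_reflection D \<gamma> = \<one>\<^bsub>W\<^esub>"
  using assms
  by (intro weyl_elt_eqI)
    (auto simp: affine_reflection_closed mult_apply one_apply affine_reflection_involutive
      affine_roots_def)

lemma linear_reflection_affine_lattice:
  assumes "\<gamma> \<in> affine_roots D" "\<mu> \<in> affine_lattice D"
  shows "linear_reflection D \<gamma> \<mu> \<in> affine_lattice D"
proof -
  have \<gamma>: "fst \<gamma> \<in> roots D" "snd \<gamma> \<in> \<int>"
    using assms(1) by (auto simp: affine_roots_def)
  have c: "coroot D (fst \<gamma>) (fst \<mu>) \<in> \<int>" and \<mu>: "snd \<mu> \<in> \<int>"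
    and \<mu>': "\<And>\<alpha>. \<alpha> \<in> roots D \<Longrightarrow> coroot D \<alpha> (fst \<mu>) \<in> \<int>"
    using assms \<gamma> by (auto simp: affine_lattice_def weight_lattice_def)
  have "coroot D \<alpha> (fst \<mu> - scl D (coroot D (fst \<gamma>) (fst \<mu>)) (fst \<gamma>)) \<in> \<int>"
    if "\<alpha> \<in> roots D" for \<alpha>
    using \<mu>'[OF that] c coroot_integral[OF that \<gamma>(1)]
    by (simp add: linear_simps[OF linear_coroot[OF that]])
  then show ?thesis
    using c \<mu> \<gamma> by (simp add: linear_reflection_def affine_lattice_def weight_lattice_def Let_def)
qed

lemma linear_action_graph_closed:
  "linear_action_graph D w f \<Longrightarrow> w \<in> carrier W"
  by (induction rule: linear_action_graph.induct) (auto simp: affine_reflection_closed)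

lemma linear_action_graph_lattice:
  "linear_action_graph D w f \<Longrightarrow> \<mu> \<in> affine_lattice D \<Longrightarrow> f \<mu> \<in> affine_lattice D"
  by (induction rule: linear_action_graph.induct) (auto simp: linear_reflection_affine_lattice)

text \<open>The linear action is adjoint to the affine action, if \<open>(\<lambda>, n)\<close> is
  read as the affine function \<open>v \<mapsto> \<langle>\<lambda>, v\<rangle> + n\<close>.\<close>

lemma linear_action_graph_pairing:
  assumes "linear_action_graph D w f" "v \<in> dual_space D"
  shows "w v (fst (f \<mu>)) + snd (f \<mu>) = v (fst \<mu>) + snd \<mu>"
  using assms
proof (induction rule: linear_action_graph.induct)
  case unit
  then show ?case by (simp add: one_apply)
next
  case (step w f \<gamma>)
  note w = linear_action_graph_closed[OF step.hyps(1)]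
  have \<gamma>: "fst \<gamma> \<in> roots D"
    using step.hyps by (auto simp: affine_roots_def)
  have wv: "w v \<in> dual_space D"
    using weyl_elt_image[OF w] step.prems by blast
  note l = linear_simps[OF wv[unfolded dual_space_iff]] linear_simps[OF linear_coroot[OF \<gamma>]]
  have "affine_reflection D \<gamma> (w v) (fst (linear_reflection D \<gamma> (f \<mu>)))
      + snd (linear_reflection D \<gamma> (f \<mu>)) = w v (fst (f \<mu>)) + snd (f \<mu>)"
    unfolding affine_reflection_apply[OF wv]
    by (simp add: linear_reflection_def Let_def l coroot_self[OF \<gamma>] ring_distribs mult_ac)
  then show ?case
    using step mult_apply[OF affine_reflection_closed[OF step.hyps(2)] w step.prems] by simp
qed

end

section \<open>The linear action as a function, and simple affine roots as determined by their
  reflections\<close>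

locale affine_root_system = simple_root_system D for D :: "'v::ab_group_add root_data" +
  assumes irreducible: "is_irreducible D"
begin

lemma coord_dual_space: "(\<lambda>\<mu>. coord \<mu> \<beta>) \<in> dual_space D"
  by (rule dual_spaceI) (simp_all add: coord_simps)

text \<open>Since w maps V* onto itself, the pairing determines the affine function attached to the
  image of \<mu> at every point of V*. The zero functional reads off its second component, the
  coordinate functionals its first.\<close>

lemma linear_action_graph_unique:
  assumes f: "linear_action_graph D w f" and g: "linear_action_graph D w g"
  shows "f = g"
proof
  fix \<mu>
  have eq: "v (fst (f \<mu>)) + snd (f \<mu>) = v (fst (g \<mu>)) + snd (g \<mu>)" if v: "v \<in> dual_space D" for v
  proof -
    obtain u where "u \<in> dual_space D" "v = w u"
      using v weyl_elt_image[OF linear_action_graph_closed[OF f]] by blast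
    then show ?thesis
      using linear_action_graph_pairing[OF f] linear_action_graph_pairing[OF g] by simp
  qed
  from eq[OF zero_dual_space] have snd: "snd (f \<mu>) = snd (g \<mu>)"
    by simp
  then have "fst (f \<mu>) = fst (g \<mu>)"
    using eq[OF coord_dual_space] by (intro coord_eqI) auto
  with snd show "f \<mu> = g \<mu>"
    by (rule prod_eqI[rotated])
qed

lemma linear_action_lattice:
  assumes "linear_action_graph D w f" "\<mu> \<in> affine_lattice D"
  shows "linear_action D w \<mu> \<in> affine_lattice D"
proof -
  have "linear_action D w = f"
    unfolding linear_action_def
    using assms(1) linear_action_graph_unique by blast
  then show ?thesis
    using linear_action_graph_lattice assms by simp
qed

lemma simple_affine_roots_subset: "simple_affine_roots D \<subseteq> affine_roots D"
  using simple_root uminus_root highest_root_root[OF irreducible]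
  by (auto simp: simple_affine_roots_def affine_roots_def)

lemma affine_roots_subset: "affine_roots D \<subseteq> affine_lattice D"
  using coroot_integral by (auto simp: affine_roots_def affine_lattice_def weight_lattice_def)

lemma positive_affine_roots_subset: "positive_affine_roots D \<subseteq> affine_roots D"
  by (auto simp: positive_affine_roots_def affine_roots_def positive_roots_def)

text \<open>This makes \<open>simple_affine_root_of\<close> return the intended root. Applied to the
  zero functional, the reflections show whether the constant term is zero, which separates the
  affine simple root from the finite ones; a coordinate functional separates the finite ones from
  each other.\<close>

lemma inj_on_affine_reflection: "inj_on (affine_reflection D) (simple_affine_roots D)"
proof (rule inj_onI)
  fix \<gamma> \<delta>
  assume \<gamma>: "\<gamma> \<in> simple_affine_roots D" and \<delta>: "\<delta> \<in> simple_affine_roots D"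
    and eq: "affine_reflection D \<gamma> = affine_reflection D \<delta>"
  have root: "fst \<gamma> \<in> roots D" "fst \<delta> \<in> roots D"
    using \<gamma> \<delta> simple_affine_roots_subset by (auto simp: affine_roots_def)
  have *: "(v (fst \<gamma>) + snd \<gamma>) * coroot D (fst \<gamma>) \<mu> = (v (fst \<delta>) + snd \<delta>) * coroot D (fst \<delta>) \<mu>"
    if "v \<in> dual_space D" for v \<mu>
    using fun_cong[OF fun_cong[OF eq], of v \<mu>] by (simp add: affine_reflection_apply[OF that])
  have zero: "snd \<gamma> = 0 \<longleftrightarrow> snd \<delta> = 0"
    using *[OF zero_dual_space, of "fst \<gamma>"] *[OF zero_dual_space, of "fst \<delta>"] root coroot_self
    by auto
  show "\<gamma> = \<delta>"
  proof (cases "snd \<gamma> = 0")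
    case True
    then have s: "fst \<gamma> \<in> simple_roots D" "fst \<delta> \<in> simple_roots D"
      using zero \<gamma> \<delta> by (auto simp: simple_affine_roots_def)
    have "fst \<gamma> = fst \<delta>"
      using *[OF coord_dual_space, of "fst \<gamma>" "fst \<gamma>"] True zero
        coroot_self[OF root(1)] coord_simple[OF s(1)] coord_simple[OF s(2)]
      by (auto split: if_splits)
    then show ?thesis
      using True zero by (intro prod_eqI) auto
  next
    case False
    then show ?thesis
      using zero \<gamma> \<delta> by (auto simp: simple_affine_roots_def)
  qed
qed

lemma simple_affine_root_of:
  assumes "s \<in> simple_reflections D"
  shows "simple_affine_root_of D s \<in> simple_affine_roots D"
proof -
  obtain \<gamma> where "\<gamma> \<in> simple_affine_roots D" "s = affine_reflection D \<gamma>"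
    using assms by (auto simp: simple_reflections_def)
  then have "simple_affine_root_of D s = \<gamma>"
    unfolding simple_affine_root_of_def
    using inj_on_affine_reflection by (intro the_equality) (auto dest: inj_onD)
  then show ?thesis
    using \<open>\<gamma> \<in> simple_affine_roots D\<close> by simp
qed

lemma simple_reflection_closed: "s \<in> simple_reflections D \<Longrightarrow> s \<in> carrier W"
  and simple_reflection_square: "s \<in> simple_reflections D \<Longrightarrow> s \<otimes>\<^bsub>W\<^esub> s = \<one>\<^bsub>W\<^esub>"
  using simple_affine_roots_subset affine_reflection_closed affine_reflection_square
  by (auto simp: simple_reflections_def)

text \<open>The existence half for \<open>linear_action\<close>, at the elements where c^alpha is
  evaluated. The graph grows by multiplication on the left, which is also the order in which
  \<open>ev\<close> folds.\<close>

lemma ev_linear_action_graph: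
  assumes "\<sigma> \<in> subsequences ss" "set ss \<subseteq> simple_reflections D"
  shows "\<exists>f. linear_action_graph D (ev D \<sigma>) f"
  using assms
proof (induction ss arbitrary: \<sigma>)
  case Nil
  then show ?case
    using linear_action_graph.unit by (auto simp: subsequences_def ev_def)
next
  case (Cons s ss)
  then obtain \<tau> c where \<sigma>: "\<sigma> = c # \<tau>" "c = None \<or> c = Some s" "\<tau> \<in> subsequences ss"
    by (auto simp: subsequences_def list_all2_Cons2)
  obtain f where f: "linear_action_graph D (ev D \<tau>) f"
    using Cons \<sigma> by auto
  obtain \<gamma> where \<gamma>: "\<gamma> \<in> affine_roots D" "s = affine_reflection D \<gamma>"
    using Cons.prems simple_affine_roots_subset by (auto simp: simple_reflections_def)
  show ?case
    using \<sigma>(1,2) f linear_action_graph.step[OF f \<gamma>(1)] \<gamma>(2) by (auto simp: ev_def)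
qed

lemma ev_closed:
  "\<sigma> \<in> subsequences ss \<Longrightarrow> set ss \<subseteq> simple_reflections D \<Longrightarrow> ev D \<sigma> \<in> carrier W"
  using ev_linear_action_graph linear_action_graph_closed by blast

end

section \<open>The ring of scalars\<close>

context
  fixes B :: "'b set"
begin

abbreviation polys :: "(('b \<Rightarrow>\<^sub>0 nat) \<Rightarrow>\<^sub>0 'f::field) ring" where
  "polys \<equiv> poly_ring B"

lemma poly_ring_add_closed:
  "p \<in> carrier polys \<Longrightarrow> q \<in> carrier polys \<Longrightarrow> p + q \<in> carrier polys"
  using Poly_Mapping.keys_add[of p q] by (auto simp: poly_ring_def)

lemma poly_ring_uminus_closed: "p \<in> carrier polys \<Longrightarrow> - p \<in> carrier polys"
  by (auto simp: poly_ring_def Poly_Mapping.keys_def)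

lemma poly_ring_minus_closed:
  "p \<in> carrier polys \<Longrightarrow> q \<in> carrier polys \<Longrightarrow> p - q \<in> carrier polys"
  using poly_ring_add_closed[OF _ poly_ring_uminus_closed] by force

lemma poly_ring_mult_closed:
  assumes "p \<in> carrier polys" "q \<in> carrier polys"
  shows "p * q \<in> carrier polys"
proof -
  have "Poly_Mapping.keys m \<subseteq> B" if m: "m \<in> Poly_Mapping.keys (p * q)" for m
  proof -
    obtain a b where "m = a + b" "a \<in> Poly_Mapping.keys p" "b \<in> Poly_Mapping.keys q"
      using m Poly_Mapping.keys_mult[of p q] by blast
    then show ?thesis
      using assms Poly_Mapping.keys_add[of a b] by (fastforce simp: poly_ring_def)
  qed
  then show ?thesis
    by (simp add: poly_ring_def)
qed

lemma poly_ring_const_closed: "Poly_Mapping.single 0 c \<in> carrier polys"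
  by (simp add: poly_ring_def)

lemma poly_var_closed: "b \<in> B \<Longrightarrow> poly_var b \<in> carrier polys"
  by (simp add: poly_ring_def poly_var_def)

lemma poly_ring_ops:
  "add polys = (+)" "mult polys = (*)" "zero polys = 0" "one polys = 1"
  by (simp_all add: poly_ring_def)

lemma cring_poly_ring: "cring (polys :: (('b \<Rightarrow>\<^sub>0 nat) \<Rightarrow>\<^sub>0 'f::field) ring)"
proof (rule cringI)
  have zero: "(0 :: ('b \<Rightarrow>\<^sub>0 nat) \<Rightarrow>\<^sub>0 'f) \<in> carrier polys"
    and one: "(1 :: ('b \<Rightarrow>\<^sub>0 nat) \<Rightarrow>\<^sub>0 'f) \<in> carrier polys"
    using poly_ring_const_closed[of 0] poly_ring_const_closed[of 1] by simp_all
  show "abelian_group (polys :: (('b \<Rightarrow>\<^sub>0 nat) \<Rightarrow>\<^sub>0 'f) ring)"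
  proof (rule abelian_groupI)
    fix p :: "('b \<Rightarrow>\<^sub>0 nat) \<Rightarrow>\<^sub>0 'f" assume "p \<in> carrier polys"
    then show "\<exists>q\<in>carrier polys. q \<oplus>\<^bsub>polys\<^esub> p = \<zero>\<^bsub>polys\<^esub>"
      using poly_ring_uminus_closed by (intro bexI[of _ "- p"]) (auto simp: poly_ring_ops)
  qed (auto simp: poly_ring_ops zero poly_ring_add_closed algebra_simps)
  show "comm_monoid (polys :: (('b \<Rightarrow>\<^sub>0 nat) \<Rightarrow>\<^sub>0 'f) ring)"
    by (rule comm_monoidI) (auto simp: poly_ring_ops one poly_ring_mult_closed algebra_simps)
qed (simp add: poly_ring_ops algebra_simps)

end

text \<open>Closure puts the defining relations of the symmetric algebra inside the polynomial ring
  on the carrier; from there, the ideal and the quotient ring are formal.\<close>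

definition closed_module :: "('f::field, 'b) module \<Rightarrow> bool" where
  "closed_module M \<longleftrightarrow>
    (\<forall>v\<in>carrier M. \<forall>w\<in>carrier M. v \<oplus>\<^bsub>M\<^esub> w \<in> carrier M) \<and>
    (\<forall>c. \<forall>v\<in>carrier M. c \<odot>\<^bsub>M\<^esub> v \<in> carrier M)"

lemma ideal_symmetric_ideal:
  fixes M :: "('f::field, 'b) module"
  assumes "closed_module M"
  shows "ideal (symmetric_ideal M) (poly_ring (carrier M))"
proof -
  interpret cring "poly_ring (carrier M) :: (('b \<Rightarrow>\<^sub>0 nat) \<Rightarrow>\<^sub>0 'f) ring"
    by (rule cring_poly_ring)
  show ?thesis
    unfolding symmetric_ideal_def
  proof (rule genideal_ideal, safe)
    fix v w assume "v \<in> carrier M" "w \<in> carrier M"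
    then show "poly_var (v \<oplus>\<^bsub>M\<^esub> w) - poly_var v - poly_var w \<in> carrier (poly_ring (carrier M))"
      using assms by (intro poly_ring_minus_closed poly_var_closed) (auto simp: closed_module_def)
  next
    fix c v assume "v \<in> carrier M"
    then show "poly_var (c \<odot>\<^bsub>M\<^esub> v) - Poly_Mapping.single 0 c * poly_var v
        \<in> carrier (poly_ring (carrier M))"
      using assms
      by (intro poly_ring_minus_closed poly_ring_mult_closed poly_ring_const_closed poly_var_closed)
        (auto simp: closed_module_def)
  qed
qed

lemma cring_symmetric_algebra:
  assumes "closed_module M"
  shows "cring (symmetric_algebra M)"
  unfolding symmetric_algebra_def
  by (intro ideal.quotient_is_cring ideal_symmetric_ideal assms cring_poly_ring)

lemma symmetric_embedding_closed:
  assumes "v \<in> carrier M"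
  shows "symmetric_embedding M v \<in> carrier (symmetric_algebra M)"
proof -
  have "poly_var v \<in> carrier (poly_ring (carrier M))"
    using assms by (rule poly_var_closed)
  then show ?thesis
    by (auto simp: symmetric_algebra_def symmetric_embedding_def FactRing_def A_RCOSETS_def'
        intro!: bexI[of _ "poly_var v"])
qed

text \<open>Scaling by c is multiplication by \<open>single 0 c\<close> for the convolution product,
  so the module laws are ring laws.\<close>

lemma module_scale_poly_mapping:
  "Modules.module (\<lambda>c. Poly_Mapping.map ((*) c) :: ('x::ab_group_add \<Rightarrow>\<^sub>0 'f::field) \<Rightarrow> _)"
  unfolding mult_map_scale_conv_mult
  by unfold_locales
    (simp_all add: ring_distribs single_add mult.assoc[symmetric] Poly_Mapping.mult_single)

lemma base_change_carrier:
  "carrier (base_change L :: ('f::field, ('x::ab_group_add \<Rightarrow>\<^sub>0 'f) set) module) =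
    {(\<lambda>h. h + p) ` tensor_relations L | p. Poly_Mapping.keys p \<subseteq> L}"
  by (auto simp: base_change_def quotient_module_def A_RCOSETS_def' a_r_coset_def' free_space_def)

text \<open>Coset operations are unions over representatives. Each union is a single coset because
  the relations form a subspace: closure gives one inclusion, and 0 as a representative of the
  relations gives the other.\<close>

lemma closed_module_base_change:
  "closed_module (base_change L :: ('f::field, ('x::ab_group_add \<Rightarrow>\<^sub>0 'f) set) module)"
proof -
  let ?M = "base_change L :: ('f, ('x \<Rightarrow>\<^sub>0 'f) set) module"
  define N where "N = (tensor_relations L :: ('x \<Rightarrow>\<^sub>0 'f) set)"
  define scale where "scale = (\<lambda>c. Poly_Mapping.map ((*) c) :: ('x \<Rightarrow>\<^sub>0 'f) \<Rightarrow> _)"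
  interpret M: Modules.module scale
    unfolding scale_def by (rule module_scale_poly_mapping)
  have sub: "M.subspace N"
    by (simp add: N_def tensor_relations_def scale_def[symmetric])
  note N0 = M.subspace_0[OF sub] and N_add = M.subspace_add[OF sub]
    and N_diff = M.subspace_diff[OF sub] and N_scale = M.subspace_scale[OF sub]
  have car: "carrier ?M = {(\<lambda>h. h + p) ` N | p. Poly_Mapping.keys p \<subseteq> L}"
    unfolding N_def by (rule base_change_carrier)
  show ?thesis
    unfolding closed_module_def
  proof (intro conjI ballI allI)
    fix v w assume "v \<in> carrier ?M" "w \<in> carrier ?M"
    then obtain p q where p: "v = (\<lambda>h. h + p) ` N" "Poly_Mapping.keys p \<subseteq> L"
      and q: "w = (\<lambda>h. h + q) ` N" "Poly_Mapping.keys q \<subseteq> L"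
      by (auto simp: car)
    have "v \<oplus>\<^bsub>?M\<^esub> w = (\<Union>a\<in>v. \<Union>b\<in>w. {a + b})"
      by (simp add: base_change_def quotient_module_def set_add_def' free_space_def)
    also have "\<dots> = (\<lambda>h. h + (p + q)) ` N"
    proof (intro subset_antisym subsetI)
      fix x assume "x \<in> (\<Union>a\<in>v. \<Union>b\<in>w. {a + b})"
      then obtain a b where "a \<in> N" "b \<in> N" "x = a + p + (b + q)"
        by (auto simp: p q)
      then show "x \<in> (\<lambda>h. h + (p + q)) ` N"
        using N_add by (intro image_eqI[of _ _ "a + b"]) (auto simp: algebra_simps)
    next
      fix x assume "x \<in> (\<lambda>h. h + (p + q)) ` N"
      then obtain a where "a \<in> N" "x = (a + p) + (0 + q)"
        by (auto simp: algebra_simps)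
      then show "x \<in> (\<Union>a\<in>v. \<Union>b\<in>w. {a + b})"
        using N0 unfolding p q by blast
    qed
    finally show "v \<oplus>\<^bsub>?M\<^esub> w \<in> carrier ?M"
      using p q Poly_Mapping.keys_add[of p q] unfolding car by blast
  next
    fix c v assume "v \<in> carrier ?M"
    then obtain p where p: "v = (\<lambda>h. h + p) ` N" "Poly_Mapping.keys p \<subseteq> L"
      by (auto simp: car)
    have "c \<odot>\<^bsub>?M\<^esub> v = (\<Union>m\<in>v. (\<lambda>h. h + scale c m) ` N)"
      by (simp add: base_change_def quotient_module_def a_r_coset_def' free_space_def scale_def N_def
          image_def) blast
    also have "\<dots> = (\<lambda>h. h + scale c p) ` N"
    proof (intro subset_antisym subsetI)
      fix x assume "x \<in> (\<Union>m\<in>v. (\<lambda>h. h + scale c m) ` N)"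
      then obtain a b where "a \<in> N" "b \<in> N" "x = a + scale c (b + p)"
        by (auto simp: p)
      then show "x \<in> (\<lambda>h. h + scale c p) ` N"
        using N_add N_scale
        by (intro image_eqI[of _ _ "a + scale c b"]) (auto simp: M.scale_right_distrib add.assoc)
    next
      fix x assume "x \<in> (\<lambda>h. h + scale c p) ` N"
      then obtain a where "a \<in> N" "x = a + scale c (0 + p)"
        by auto
      then show "x \<in> (\<Union>m\<in>v. (\<lambda>h. h + scale c m) ` N)"
        using N0 unfolding p by blast
    qed
    finally have "c \<odot>\<^bsub>?M\<^esub> v = (\<lambda>h. h + scale c p) ` N" .
    moreover have "Poly_Mapping.keys (scale c p) \<subseteq> L"
      using p(2) by (auto simp: scale_def in_keys_iff Poly_Mapping.map.rep_eq when_def split: if_splits)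
    ultimately show "c \<odot>\<^bsub>?M\<^esub> v \<in> carrier ?M"
      unfolding car by blast
  qed
qed

lemma tensor_one_closed: "a \<in> L \<Longrightarrow> tensor_one L a \<in> carrier (base_change L)"
  by (auto simp: base_change_carrier tensor_one_def a_r_coset_def' free_space_def image_def
      intro!: exI[of _ "Poly_Mapping.single a 1"])

lemma cring_scalars: "cring (scalars D)"
  unfolding scalars_def label_space_def
  by (intro cring_symmetric_algebra closed_module_base_change)

lemma label_scalar_closed:
  "\<mu> \<in> affine_lattice D \<Longrightarrow> label_scalar D (lattice_bar D \<mu>) \<in> carrier (scalars D)"
  unfolding label_scalar_def lattice_bar_def scalars_def label_space_def
  by (intro symmetric_embedding_closed tensor_one_closed)

lemma scalar_module_simps:
  "carrier (scalar_module D) = carrier (scalars D)"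
  "zero (scalar_module D) = zero (scalars D)"
  "add (scalar_module D) = add (scalars D)"
  "smult (scalar_module D) = mult (scalars D)"
  by (simp_all add: scalar_module_def symmetric_regular_module_def scalars_def)

section \<open>The combinatorial model takes values in the ring of scalars\<close>

context affine_root_system
begin

lemma weight_section_closed:
  assumes "\<sigma> \<in> subsequences ss" "set ss \<subseteq> simple_reflections D" "\<mu> \<in> affine_lattice D"
  shows "(weight_section D \<mu> (ev D \<sigma>) :: ('v, 'f::field) scalar) \<in> carrier (scalars D)"
  using ev_linear_action_graph[OF assms(1,2)] linear_action_lattice assms(3) label_scalar_closed
  unfolding weight_section_def by blast

text \<open>Needed for cancelling sums of values. \<open>Delta\<close> reads its argument at
  \<open>butlast \<sigma>\<close>, which is a subsequence of the shorter sequence, so the induction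
  hypothesis applies.\<close>

lemma X_reversed_closed:
  assumes "set rs \<subseteq> simple_reflections D"
    and "(f :: 'v weyl_elt option list \<Rightarrow> ('v, 'f::field) scalar) \<in> X_reversed D rs"
  shows "f \<in> (\<Pi>\<^sub>E \<sigma>\<in>subsequences (rev rs). carrier (scalars D))"
  using assms
proof (induction rs arbitrary: f)
  case Nil
  then show ?case by simp
next
  case (Cons s rs)
  interpret cring "scalars D :: ('v, 'f) scalar ring"
    by (rule cring_scalars)
  let ?ss = "rev (s # rs)"
  have butlast: "butlast \<sigma> \<in> subsequences (rev rs)" if "\<sigma> \<in> subsequences ?ss" for \<sigma>
    using that by (auto simp: subsequences_def list_all2_append2 list_all2_Cons2)
  have \<alpha>: "simple_affine_root_of D s \<in> affine_lattice D"
    using Cons.prems simple_affine_root_of simple_affine_roots_subset affine_roots_subset by auto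
  have c: "(weight_section D (simple_affine_root_of D s) (ev D \<sigma>) :: ('v, 'f) scalar)
      \<in> carrier (scalars D)"
    if "\<sigma> \<in> subsequences ?ss" for \<sigma>
    using weight_section_closed[OF that _ \<alpha>] Cons.prems(1) by simp
  have D: "(Delta ?ss g \<sigma> :: ('v, 'f) scalar) \<in> carrier (scalars D)"
    if "g \<in> X_reversed D rs" "\<sigma> \<in> subsequences ?ss" for g \<sigma>
    using Cons.IH[of g] Cons.prems butlast that by (auto simp: Delta_def)
  obtain g h where gh: "g \<in> X_reversed D rs" "h \<in> X_reversed D rs"
    and f: "f = (\<lambda>\<sigma>\<in>subsequences ?ss. Delta ?ss g \<sigma> \<oplus>\<^bsub>scalars D\<^esub>
      weight_section D (simple_affine_root_of D s) (ev D \<sigma>) \<otimes>\<^bsub>scalars D\<^esub> Delta ?ss h \<sigma>)"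
    using Cons.prems(2) by auto
  show ?case
    unfolding f restrict_PiE_iff
    using D[OF gh(1)] D[OF gh(2)] c by blast
qed

lemma X_set_closed:
  assumes "set ss \<subseteq> simple_reflections D"
    and "(f :: 'v weyl_elt option list \<Rightarrow> ('v, 'f::field) scalar) \<in> X_set D ss"
  shows "f \<in> (\<Pi>\<^sub>E \<sigma>\<in>subsequences ss. carrier (scalars D))"
  using X_reversed_closed[of "rev ss" f] assms by (simp add: X_set_def)

end

section \<open>Bott--Samelson sheaves and sections supported at a vertex\<close>

lemma theta_on_stalk_simps:
  "carrier (theta_on_stalk D P X) = Family ` sections_over (affine_moment_graph D) P X"
  "zero (theta_on_stalk D P X) = Family (\<lambda>i\<in>X. \<zero>\<^bsub>stalk P i\<^esub>)"
  "add (theta_on_stalk D P X) =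
    (\<lambda>m n. Family (\<lambda>i\<in>X. un_Family m i \<oplus>\<^bsub>stalk P i\<^esub> un_Family n i))"
  "smult (theta_on_stalk D P X) =
    (\<lambda>a m. Family (\<lambda>i\<in>X. a \<odot>\<^bsub>stalk P i\<^esub> un_Family m i))"
  by (simp_all add: theta_on_stalk_def transport_module_def section_module_def restrict_module_def
      product_module_def)

section \<open>Edges and cosets, and the invariant preserved by translation\<close>

context affine_root_system
begin

abbreviation G :: "('v weyl_elt, ('v, 'f::field) label) moment_graph" where
  "G \<equiv> affine_moment_graph D"

lemma edgeE:
  assumes "E \<in> edges G"
  obtains x \<alpha> y where "E = (x, lattice_bar D \<alpha>, y)" "x \<in> carrier W" "y \<in> carrier W"
    "\<alpha> \<in> positive_affine_roots D" "bruhat_less W (simple_reflections D) x y" "x \<noteq> y"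
    "y = affine_reflection D \<alpha> \<otimes>\<^bsub>W\<^esub> x"
proof -
  obtain x \<alpha> y where "E = (x, lattice_bar D \<alpha>, y)" "x \<in> carrier W" "y \<in> carrier W"
    "\<alpha> \<in> positive_affine_roots D" "bruhat_less W (simple_reflections D) x y"
    "y = affine_reflection D \<alpha> \<otimes>\<^bsub>W\<^esub> x"
    using assms unfolding affine_moment_graph_def Let_def moment_graph.select_convs by blast
  moreover from this have "x \<noteq> y"
    using bruhat_less_length[of W _ x y] by blast
  ultimately show thesis
    using that by blast
qed

lemma ends_closed: "E \<in> edges G \<Longrightarrow> x \<in> ends E \<Longrightarrow> x \<in> carrier W"
  by (elim edgeE) (auto simp: ends_def edge_source_def edge_target_def)

lemma edge_source_neq_target: "E \<in> edges G \<Longrightarrow> edge_source E \<noteq> edge_target E"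
  by (elim edgeE) (simp add: edge_source_def edge_target_def)

lemma edge_label_closed:
  assumes "E \<in> edges (G :: ('v weyl_elt, ('v, 'f::field) label) moment_graph)"
  shows "label_scalar D (edge_label E) \<in> carrier (scalars D)"
  using assms positive_affine_roots_subset affine_roots_subset
  by (elim edgeE) (auto simp: edge_label_def intro!: label_scalar_closed)

lemma coset_pair_subset:
  "s \<in> simple_reflections D \<Longrightarrow> x \<in> carrier W \<Longrightarrow> coset_pair D s x \<subseteq> carrier W"
  by (auto simp: coset_pair_def simple_reflection_closed)

text \<open>The case y = xs is where s^2 = 1 enters: ys is x again.\<close>

lemma coset_pair_eq:
  assumes "s \<in> simple_reflections D" "x \<in> carrier W" "y \<in> coset_pair D s x"
  shows "coset_pair D s y = coset_pair D s x"
  using assms simple_reflection_closed[OF assms(1)] simple_reflection_square[OF assms(1)]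
  by (auto simp: coset_pair_def W.m_assoc)

text \<open>The law for a multiple of m plus zero stands apart from the law for m, because closure
  of the stalks under scalars is not part of the invariant; for spaces of sections it would require
  linear maps \<open>rho\<close>. This separate law is what identifies zero in the quotient by l M
  on edges joining x and xs.\<close>

definition vanishing_at_zero :: "('v, 'f::field) affine_sheaf \<Rightarrow> bool" where
  "vanishing_at_zero P \<longleftrightarrow>
    (\<forall>x\<in>carrier W. \<zero>\<^bsub>stalk P x\<^esub> \<in> carrier (stalk P x) \<and>
      (\<forall>m\<in>carrier (stalk P x). m \<oplus>\<^bsub>stalk P x\<^esub> \<zero>\<^bsub>stalk P x\<^esub> = m \<and>
        (\<forall>a\<in>carrier (scalars D). (a \<odot>\<^bsub>stalk P x\<^esub> m) \<oplus>\<^bsub>stalk P x\<^esub> \<zero>\<^bsub>stalk P x\<^esub> = a \<odot>\<^bsub>stalk P x\<^esub> m))) \<and>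
    (\<forall>E\<in>edges G. \<forall>x\<in>ends E. rho P x E \<zero>\<^bsub>stalk P x\<^esub> = \<zero>\<^bsub>edge_stalk P E\<^esub>)"

lemma vanishing_at_zeroD:
  assumes "vanishing_at_zero (P :: ('v, 'f::field) affine_sheaf)"
  shows "x \<in> carrier W \<Longrightarrow> \<zero>\<^bsub>stalk P x\<^esub> \<in> carrier (stalk P x)"
    and "x \<in> carrier W \<Longrightarrow> m \<in> carrier (stalk P x) \<Longrightarrow> m \<oplus>\<^bsub>stalk P x\<^esub> \<zero>\<^bsub>stalk P x\<^esub> = m"
    and "x \<in> carrier W \<Longrightarrow> m \<in> carrier (stalk P x) \<Longrightarrow> a \<in> carrier (scalars D) \<Longrightarrow>
      (a \<odot>\<^bsub>stalk P x\<^esub> m) \<oplus>\<^bsub>stalk P x\<^esub> \<zero>\<^bsub>stalk P x\<^esub> = a \<odot>\<^bsub>stalk P x\<^esub> m"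
    and "E \<in> edges G \<Longrightarrow> x \<in> ends E \<Longrightarrow> rho P x E \<zero>\<^bsub>stalk P x\<^esub> = \<zero>\<^bsub>edge_stalk P E\<^esub>"
  using assms unfolding vanishing_at_zero_def by blast+

lemma vanishing_at_zero_unit_sheaf:
  "vanishing_at_zero (unit_sheaf D :: ('v, 'f::field) affine_sheaf)"
proof -
  interpret cring "scalars D :: ('v, 'f) scalar ring"
    by (rule cring_scalars)
  show ?thesis
    by (auto simp: vanishing_at_zero_def unit_sheaf_def transport_module_def zero_module_def
        scalar_module_simps)
qed

lemma stalk_theta:
  "x \<in> carrier W \<Longrightarrow> stalk (theta D s P) x = theta_on_stalk D P (coset_pair D s x)"
  by (simp add: theta_def theta_out_def theta_on_def quotient_moment_graph_def Let_def)

lemma zero_section: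
  assumes P: "vanishing_at_zero (P :: ('v, 'f::field) affine_sheaf)" and X: "X \<subseteq> carrier W"
  shows "(\<lambda>i\<in>X. \<zero>\<^bsub>stalk P i\<^esub>) \<in> sections_over G P X"
  using assms unfolding sections_over_def vanishing_at_zero_def
  by (auto simp: ends_def)

text \<open>Edge stalks of \<open>theta_on\<close> are specified only on edges of the quotient
  graph, so the induced edge must be recognised as one. Left multiplication by a reflection commutes
  with right multiplication by s and hence carries one coset onto the other.\<close>

lemma induced_edge_mem:
  assumes s: "s \<in> simple_reflections D"
    and E: "E \<in> edges (G :: ('v weyl_elt, ('v, 'f::field) label) moment_graph)"
    and ne: "edge_target E \<noteq> edge_source E \<otimes>\<^bsub>W\<^esub> s"
  shows "induced_edge D s E \<in> edges (quotient_moment_graph D s)"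
    and "coset_pair D s (edge_source E) \<noteq> coset_pair D s (edge_target E)"
proof -
  obtain x \<alpha> y where E': "E = (x, lattice_bar D \<alpha>, y)" "x \<in> carrier W" "y \<in> carrier W"
    "\<alpha> \<in> positive_affine_roots D" "bruhat_less W (simple_reflections D) x y" "x \<noteq> y"
    "y = affine_reflection D \<alpha> \<otimes>\<^bsub>W\<^esub> x"
    using edgeE[OF E] by metis
  have "y \<notin> coset_pair D s x" "y \<in> coset_pair D s y"
    using ne E' by (auto simp: edge_source_def edge_target_def coset_pair_def)
  then have neq: "coset_pair D s x \<noteq> coset_pair D s y"
    by auto
  then show "coset_pair D s (edge_source E) \<noteq> coset_pair D s (edge_target E)"
    by (simp add: E'(1) edge_source_def edge_target_def)
  have r: "affine_reflection D \<alpha> \<in> carrier W"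
    using E' positive_affine_roots_subset affine_reflection_closed by blast
  have img: "(\<lambda>z. affine_reflection D \<alpha> \<otimes>\<^bsub>W\<^esub> z) ` coset_pair D s x = coset_pair D s y"
    using E' simple_reflection_closed[OF s] r by (simp add: coset_pair_def W.m_assoc)
  have less: "\<exists>u\<in>coset_pair D s x. \<exists>v\<in>coset_pair D s y. bruhat_less W (simple_reflections D) u v"
    using E'(5) by (auto simp: coset_pair_def)
  have "induced_edge D s E = (coset_pair D s x, lattice_bar D \<alpha>, coset_pair D s y)"
    by (simp add: induced_edge_def E'(1) edge_source_def edge_target_def edge_label_def)
  then show "induced_edge D s E \<in> edges (quotient_moment_graph D s)"
    unfolding quotient_moment_graph_def Let_def moment_graph.select_convs
    using E'(2,3,4) neq less img
    by (intro CollectI exI[of _ "coset_pair D s x"] exI[of _ \<alpha>] exI[of _ "coset_pair D s y"]) simp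
qed

text \<open>For each lift, \<open>theta_on_rho\<close> selects by description the end that lies in
  the given coset. A lift has the same two cosets at its ends as E, and these differ, so exactly one
  end qualifies; there the zero family gives zero.\<close>

lemma theta_on_rho_zero:
  assumes P: "vanishing_at_zero (P :: ('v, 'f::field) affine_sheaf)"
    and s: "s \<in> simple_reflections D" and E: "E \<in> edges G" and x: "x \<in> ends E"
    and ne: "edge_target E \<noteq> edge_source E \<otimes>\<^bsub>W\<^esub> s"
  shows "theta_on_rho D s P (coset_pair D s x) (induced_edge D s E)
      \<zero>\<^bsub>theta_on_stalk D P (coset_pair D s x)\<^esub>
    = Family (\<lambda>E'\<in>edge_lifts D s (induced_edge D s E). \<zero>\<^bsub>edge_stalk P E'\<^esub>)"
proof -
  let ?Y = "coset_pair D s x"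
  have "rho P z E' (un_Family \<zero>\<^bsub>theta_on_stalk D P ?Y\<^esub> z) = \<zero>\<^bsub>edge_stalk P E'\<^esub>"
    if E': "E' \<in> edge_lifts D s (induced_edge D s E)" and z: "z = (THE z. z \<in> ?Y \<and> z \<in> ends E')"
    for E' z
  proof -
    have edge: "E' \<in> edges G"
      and ind: "coset_pair D s (edge_source E') = coset_pair D s (edge_source E)"
        "coset_pair D s (edge_target E') = coset_pair D s (edge_target E)"
      using E' by (auto simp: edge_lifts_def induced_edge_def)
    have neq: "coset_pair D s (edge_source E) \<noteq> coset_pair D s (edge_target E)"
      using induced_edge_mem(2)[OF s E ne] .
    have mem: "u \<in> ?Y \<longleftrightarrow> coset_pair D s u = ?Y" for u
    proof
      show "u \<in> ?Y \<Longrightarrow> coset_pair D s u = ?Y"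
        by (rule coset_pair_eq[OF s ends_closed[OF E x]])
      have "u \<in> coset_pair D s u"
        by (simp add: coset_pair_def)
      then show "coset_pair D s u = ?Y \<Longrightarrow> u \<in> ?Y"
        by (rule back_subst[of "\<lambda>X. u \<in> X"])
    qed
    consider (source) "edge_source E' \<in> ?Y" "edge_target E' \<notin> ?Y"
      | (target) "edge_source E' \<notin> ?Y" "edge_target E' \<in> ?Y"
    proof (cases "x = edge_source E")
      case True
      then have "edge_source E' \<in> ?Y" "edge_target E' \<notin> ?Y"
        unfolding mem ind using neq by simp_all
      then show ?thesis by (rule source)
    next
      case False
      then have "x = edge_target E"
        using x by (simp add: ends_def)
      then have "edge_source E' \<notin> ?Y" "edge_target E' \<in> ?Y"
        unfolding mem ind using neq by simp_all
      then show ?thesis by (rule target)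
    qed
    then have "\<exists>!z. z \<in> ?Y \<and> z \<in> ends E'"
      by cases (auto simp: ends_def)
    then have "z \<in> ?Y \<and> z \<in> ends E'"
      unfolding z by (rule theI')
    then show ?thesis
      using P edge by (simp add: theta_on_stalk_simps vanishing_at_zero_def)
  qed
  then show ?thesis
    unfolding theta_on_rho_def Let_def by (auto intro!: restrict_ext)
qed

lemma vanishing_at_zero_theta:
  assumes P: "vanishing_at_zero (P :: ('v, 'f::field) affine_sheaf)"
    and s: "s \<in> simple_reflections D"
  shows "vanishing_at_zero (theta D s P)"
  unfolding vanishing_at_zero_def
proof (intro conjI ballI)
  fix x assume x: "x \<in> carrier W"
  let ?X = "coset_pair D s x"
  have X: "?X \<subseteq> carrier W"
    using coset_pair_subset[OF s x] .
  note [simp] = stalk_theta[OF x] theta_on_stalk_simps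
  show "\<zero>\<^bsub>stalk (theta D s P) x\<^esub> \<in> carrier (stalk (theta D s P) x)"
    using zero_section[OF P X] by simp
  fix m assume "m \<in> carrier (stalk (theta D s P) x)"
  then obtain f where m: "m = Family f" and f: "f \<in> (\<Pi>\<^sub>E i\<in>?X. carrier (stalk P i))"
    by (auto simp: sections_over_def)
  have "(\<lambda>i\<in>?X. f i \<oplus>\<^bsub>stalk P i\<^esub> \<zero>\<^bsub>stalk P i\<^esub>) = f"
    using P X f by (intro ext) (auto simp: vanishing_at_zero_def PiE_def extensional_def Pi_def)
  then show "m \<oplus>\<^bsub>stalk (theta D s P) x\<^esub> \<zero>\<^bsub>stalk (theta D s P) x\<^esub> = m"
    by (simp add: m cong: restrict_cong)
  fix a assume a: "a \<in> carrier (scalars D :: ('v, 'f) scalar ring)"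
  show "(a \<odot>\<^bsub>stalk (theta D s P) x\<^esub> m) \<oplus>\<^bsub>stalk (theta D s P) x\<^esub> \<zero>\<^bsub>stalk (theta D s P) x\<^esub>
      = a \<odot>\<^bsub>stalk (theta D s P) x\<^esub> m"
    using vanishing_at_zeroD(3)[OF P _ PiE_mem[OF f] a] X by (auto simp: m intro!: restrict_ext)
next
  fix E x assume E: "E \<in> edges (G :: ('v weyl_elt, ('v, 'f) label) moment_graph)" and x: "x \<in> ends E"
  have xW: "x \<in> carrier W"
    using ends_closed[OF E x] .
  have src: "edge_source E \<in> carrier W"
    using ends_closed[OF E] by (simp add: ends_def)
  show "rho (theta D s P) x E \<zero>\<^bsub>stalk (theta D s P) x\<^esub> = \<zero>\<^bsub>edge_stalk (theta D s P) E\<^esub>"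
  proof (cases "edge_target E = edge_source E \<otimes>\<^bsub>W\<^esub> s")
    case True
    let ?X = "coset_pair D s (edge_source E)"
    let ?M = "theta_on_stalk D P ?X"
    let ?l = "label_scalar D (edge_label E)"
    let ?lM = "{?l \<odot>\<^bsub>?M\<^esub> m | m. m \<in> carrier ?M}"
    \<comment> \<open>Zero is taken in the stalk at x, the quotient in the stalk at the source of E;
      both belong to the same coset.\<close>
    have "x \<in> ?X"
      using x True by (auto simp: ends_def coset_pair_def)
    then have Xx: "coset_pair D s x = ?X"
      by (rule coset_pair_eq[OF s src])
    have Q: "stalk (theta_on D s P) ?X = ?M"
      using src by (simp add: theta_on_def quotient_moment_graph_def Let_def)
    have X: "?X \<subseteq> carrier W"
      using coset_pair_subset[OF s src] .
    have "(?l \<odot>\<^bsub>?M\<^esub> m) \<oplus>\<^bsub>?M\<^esub> \<zero>\<^bsub>?M\<^esub> = ?l \<odot>\<^bsub>?M\<^esub> m" if m: "m \<in> carrier ?M" for m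
    proof -
      obtain f where "m = Family f" and f: "f \<in> (\<Pi>\<^sub>E i\<in>?X. carrier (stalk P i))"
        using m by (auto simp: theta_on_stalk_simps sections_over_def)
      then show ?thesis
        using vanishing_at_zeroD(3)[OF P _ PiE_mem[OF f] edge_label_closed[OF E]] X
        by (auto simp: theta_on_stalk_simps intro!: restrict_ext)
    qed
    \<comment> \<open>The zero of the quotient is l M itself, whereas \<open>rho\<close> produces
      the coset l M + 0; the law just shown identifies the two.\<close>
    then have "?lM +>\<^bsub>?M\<^esub> \<zero>\<^bsub>?M\<^esub> = ?lM"
      unfolding a_r_coset_def' by force
    then show ?thesis
      using True
      by (simp add: stalk_theta[OF xW] Xx theta_def theta_out_def Q transport_module_def
          graded_quotient_module_def quotient_module_def module.defs)
  next
    case False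
    have "\<zero>\<^bsub>edge_stalk (theta D s P) E\<^esub> =
        Family (\<lambda>E'\<in>edge_lifts D s (induced_edge D s E). \<zero>\<^bsub>edge_stalk P E'\<^esub>)"
      using False induced_edge_mem(1)[OF s E False]
      by (simp add: theta_def theta_out_def theta_on_def Let_def restrict_module_def
          transport_module_def product_module_def)
    moreover have "rho (theta D s P) x E = theta_on_rho D s P (coset_pair D s x) (induced_edge D s E)"
      using False by (simp add: theta_def theta_out_def theta_on_def Let_def)
    ultimately show ?thesis
      using theta_on_rho_zero[OF P s E x False] by (simp add: stalk_theta[OF xW])
  qed
qed

lemma vanishing_at_zero_bott_samelson:
  assumes "set ss \<subseteq> simple_reflections D"
  shows "vanishing_at_zero (bott_samelson D ss :: ('v, 'f::field) affine_sheaf)"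
proof -
  have "vanishing_at_zero P \<Longrightarrow> vanishing_at_zero (fold (theta D) ss P)"
    for P :: "('v, 'f) affine_sheaf"
    using assms by (induction ss arbitrary: P) (auto intro: vanishing_at_zero_theta)
  then show ?thesis
    unfolding bott_samelson_def using vanishing_at_zero_unit_sheaf by blast
qed

text \<open>Both ends of every edge are sent to zero: at x by the condition defining the costalk,
  elsewhere because \<open>rho\<close> kills zero. So the gluing conditions hold.\<close>

lemma extend_by_zero_section:
  assumes P: "vanishing_at_zero (P :: ('v, 'f::field) affine_sheaf)" and x: "x \<in> carrier W"
    and m: "m \<in> carrier (costalk G P x)"
  shows "(\<lambda>y\<in>carrier W. if y = x then m else \<zero>\<^bsub>stalk P y\<^esub>) \<in> sections_over G P (carrier W)"
    (is "?M \<in> _")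
proof -
  have m': "m \<in> carrier (stalk P x)"
    "\<And>E. E \<in> edges G \<Longrightarrow> x \<in> ends E \<Longrightarrow> rho P x E m = \<zero>\<^bsub>edge_stalk P E\<^esub>"
    using m by (auto simp: costalk_def restrict_module_def)
  have "rho P y E (?M y) = \<zero>\<^bsub>edge_stalk P E\<^esub>"
    if E: "E \<in> edges G" and y: "y \<in> ends E" and xE: "x \<in> ends E" for E y
    using m'(2)[OF E] P E y ends_closed[OF E y] by (auto simp: vanishing_at_zero_def)
  moreover have "rho P y E (?M y) = \<zero>\<^bsub>edge_stalk P E\<^esub>"
    if E: "E \<in> edges G" and y: "y \<in> ends E" and xE: "x \<notin> ends E" for E y
    using P E y xE ends_closed[OF E y] by (auto simp: vanishing_at_zero_def)
  ultimately have rho: "rho P y E (?M y) = \<zero>\<^bsub>edge_stalk P E\<^esub>" if "E \<in> edges G" "y \<in> ends E" for E y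
    using that by blast
  have stalks: "?M \<in> (\<Pi>\<^sub>E y\<in>carrier W. carrier (stalk P y))"
    using m'(1) P by (auto simp: vanishing_at_zero_def)
  show ?thesis
    unfolding sections_over_def mem_Collect_eq
  proof (intro conjI ballI impI stalks)
    fix E :: "('v weyl_elt, ('v, 'f) label) edge" assume E: "E \<in> edges G"
    have ends: "edge_source E \<in> ends E" "edge_target E \<in> ends E"
      by (simp_all add: ends_def)
    show "rho P (edge_source E) E (?M (edge_source E)) = rho P (edge_target E) E (?M (edge_target E))"
      by (rule trans[OF rho[OF E ends(1)] rho[OF E ends(2), symmetric]])
  qed
qed

text \<open>The map preserves zero since its values lie in a product of copies of the scalars, where
  addition is cancellative.\<close>

lemma iso_X_stalk_zero:
  assumes P: "vanishing_at_zero (P :: ('v, 'f::field) affine_sheaf)" and y: "y \<in> carrier W"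
    and ss: "set ss \<subseteq> simple_reflections D"
    and h: "h \<in> module_iso (scalars D) (stalk P y) (X_stalk D ss y)"
  shows "h \<zero>\<^bsub>stalk P y\<^esub> = (\<lambda>\<sigma>\<in>subsequences_at D ss y. \<zero>\<^bsub>scalars D\<^esub>)"
proof -
  interpret cring "scalars D :: ('v, 'f) scalar ring"
    by (rule cring_scalars)
  let ?z = "\<zero>\<^bsub>stalk P y\<^esub>"
  have z: "?z \<in> carrier (stalk P y)" "?z \<oplus>\<^bsub>stalk P y\<^esub> ?z = ?z"
    using P y by (auto simp: vanishing_at_zero_def)
  have "h ?z \<in> carrier (X_stalk D ss y)"
    using h z by (auto simp: module_iso_def bij_betw_def)
  then obtain f where f: "f \<in> X_set D ss" "h ?z = restrict f (subsequences_at D ss y)"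
    by (auto simp: X_stalk_def restrict_module_def)
  have "h ?z = h ?z \<oplus>\<^bsub>X_stalk D ss y\<^esub> h ?z"
    using h z by (force simp: module_iso_def)
  then have double: "h ?z = (\<lambda>\<sigma>\<in>subsequences_at D ss y. h ?z \<sigma> \<oplus>\<^bsub>scalars D\<^esub> h ?z \<sigma>)"
    by (simp add: X_stalk_def restrict_module_def product_module_def scalar_module_simps)
  have "f \<sigma> = f \<sigma> \<oplus>\<^bsub>scalars D\<^esub> f \<sigma>" if "\<sigma> \<in> subsequences_at D ss y" for \<sigma>
  proof -
    have "h ?z \<sigma> = h ?z \<sigma> \<oplus>\<^bsub>scalars D\<^esub> h ?z \<sigma>"
      by (rule trans[OF fun_cong[OF double, of \<sigma>]]) (simp add: that)
    then show ?thesis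
      unfolding f(2) by (simp only: restrict_apply'[OF that])
  qed
  moreover have "f \<sigma> \<in> carrier (scalars D)" if "\<sigma> \<in> subsequences_at D ss y" for \<sigma>
    using that X_set_closed[OF ss f(1)] by (auto simp: subsequences_at_def)
  ultimately show ?thesis
    unfolding f(2) by (intro restrict_ext) (metis add.r_cancel_one')
qed

end

section \<open>Matching sections and model elements supported at one vertex\<close>

theorem corollary4p5p2:
  fixes D :: "'v::ab_group_add root_data"
    and ss :: "'v weyl_elt list"
    and \<phi> :: "('v weyl_elt \<Rightarrow> ('v, 'f::field) stalk_elt)
                \<Rightarrow> ('v weyl_elt option list \<Rightarrow> ('v, 'f) scalar)"
    and \<phi>\<^sub>x :: "'v weyl_elt \<Rightarrow> ('v, 'f) stalk_elt
                \<Rightarrow> ('v weyl_elt option list \<Rightarrow> ('v, 'f) scalar)"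
    and x :: "'v weyl_elt"
  assumes "is_root_system D" and "is_reduced D" and "is_irreducible D"
    and "is_simple_system D"
    and "CHAR('f) \<noteq> 2"
    and "set ss \<subseteq> simple_reflections D"
    and "GKM_property (label_space D :: ('f, ('v, 'f) label) module)
           (full_subgraph (affine_moment_graph D) (J D ss))"
    and "\<phi> \<in> module_iso (structure_algebra D (J D ss))
               (global_sections D (bott_samelson D ss) (J D ss)) (X_module D ss)"
    and "\<And>y. y \<in> carrier (affine_weyl_group D) \<Longrightarrow>
           \<phi>\<^sub>x y \<in> module_iso (scalars D) (stalk (bott_samelson D ss) y) (X_stalk D ss y)"
    and "\<And>y m. y \<in> carrier (affine_weyl_group D) \<Longrightarrow>
           m \<in> carrier (global_sections D (bott_samelson D ss) (J D ss)) \<Longrightarrow>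
           \<phi>\<^sub>x y (m y) = restrict (\<phi> m) (subsequences_at D ss y)"
    and "x \<in> carrier (affine_weyl_group D)"
  shows "\<phi>\<^sub>x x \<in> module_iso (scalars D)
           (costalk (affine_moment_graph D) (bott_samelson D ss) x) (X_costalk D ss x)"
proof -
  interpret affine_root_system D
    using assms by unfold_locales
  let ?B = "bott_samelson D ss :: ('v, 'f) affine_sheaf"
  let ?S = "sections_over G ?B (carrier W)"
  have B: "vanishing_at_zero ?B"
    by (rule vanishing_at_zero_bott_samelson) (rule assms)
  note zero_stalk = vanishing_at_zeroD(1)[OF B] and zero_rho = vanishing_at_zeroD(4)[OF B]
  have bij: "bij_betw \<phi> ?S (X_set D ss)"
    using assms(8)
    by (simp add: module_iso_def global_sections_def with_scalars_def section_module_def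
        restrict_module_def X_module_def)
  have local: "\<phi>\<^sub>x y (M y) = restrict (\<phi> M) (subsequences_at D ss y)"
    if "y \<in> carrier W" "M \<in> ?S" for y M
    using assms(10)[OF that(1), of M] that(2)
    by (simp add: global_sections_def with_scalars_def section_module_def restrict_module_def)
  have zero: "\<phi>\<^sub>x y \<zero>\<^bsub>stalk ?B y\<^esub> = (\<lambda>\<sigma>\<in>subsequences_at D ss y. \<zero>\<^bsub>scalars D\<^esub>)"
    if "y \<in> carrier W" for y
    by (rule iso_X_stalk_zero[OF B that assms(6) assms(9)[OF that]])
  have inj: "inj_on (\<phi>\<^sub>x y) (carrier (stalk ?B y))" if "y \<in> carrier W" for y
    using assms(9)[OF that] by (simp add: module_iso_def bij_betw_def)
  have sub: "carrier (costalk G ?B x) \<subseteq> carrier (stalk ?B x)"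
    by (auto simp: costalk_def restrict_module_def)
  have X_costalk: "carrier (X_costalk D ss x :: (('v, 'f) scalar, _) graded_module) =
      {restrict f (subsequences_at D ss x) | f. f \<in> X_set D ss \<and>
        (\<forall>\<sigma>\<in>subsequences ss - subsequences_at D ss x. f \<sigma> = \<zero>\<^bsub>scalars D\<^esub>)}"
    by (simp add: X_costalk_def restrict_module_def)
  have "\<phi>\<^sub>x x ` carrier (costalk G ?B x) = carrier (X_costalk D ss x)"
  proof (intro subset_antisym subsetI)
    fix g assume "g \<in> \<phi>\<^sub>x x ` carrier (costalk G ?B x)"
    then obtain m where m: "m \<in> carrier (costalk G ?B x)" and g: "g = \<phi>\<^sub>x x m"
      by blast
    define M where "M = (\<lambda>y\<in>carrier W. if y = x then m else \<zero>\<^bsub>stalk ?B y\<^esub>)"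
    have M: "M \<in> ?S"
      unfolding M_def by (rule extend_by_zero_section[OF B assms(11) m])
    have "\<phi> M \<sigma> = \<zero>\<^bsub>scalars D\<^esub>" if \<sigma>: "\<sigma> \<in> subsequences ss - subsequences_at D ss x" for \<sigma>
    proof -
      \<comment> \<open>\<sigma> lies in the fibre over its own value ?y, which differs from x, and
        M is zero there; compatibility with \<open>\<phi>\<^sub>x ?y\<close> makes \<phi> M vanish
        on that whole fibre.\<close>
      let ?y = "ev D \<sigma>"
      have y: "?y \<in> carrier W" "?y \<noteq> x" "\<sigma> \<in> subsequences_at D ss ?y"
        using \<sigma> ev_closed assms(6) by (auto simp: subsequences_at_def)
      have "restrict (\<phi> M) (subsequences_at D ss ?y) = \<phi>\<^sub>x ?y (M ?y)"
        by (rule local[OF y(1) M, symmetric])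
      also have "\<dots> = (\<lambda>\<sigma>\<in>subsequences_at D ss ?y. \<zero>\<^bsub>scalars D\<^esub>)"
        using zero[OF y(1)] y(1,2) by (simp add: M_def)
      finally show ?thesis
        using y(3) by (metis restrict_apply')
    qed
    moreover have "g = restrict (\<phi> M) (subsequences_at D ss x)"
      using local[OF assms(11) M] assms(11) by (simp add: g M_def)
    moreover have "\<phi> M \<in> X_set D ss"
      using bij M by (auto simp: bij_betw_def)
    ultimately show "g \<in> carrier (X_costalk D ss x)"
      unfolding X_costalk by blast
  next
    fix g assume "g \<in> carrier (X_costalk D ss x :: (('v, 'f) scalar, _) graded_module)"
    then obtain f where f: "f \<in> X_set D ss" "g = restrict f (subsequences_at D ss x)"
      and vanish: "\<And>\<sigma>. \<sigma> \<in> subsequences ss - subsequences_at D ss x \<Longrightarrow> f \<sigma> = \<zero>\<^bsub>scalars D\<^esub>"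
      unfolding X_costalk by blast
    obtain M where M: "M \<in> ?S" "f = \<phi> M"
      using bij f(1) unfolding bij_betw_def by blast
    have stalks: "M y \<in> carrier (stalk ?B y)" if "y \<in> carrier W" for y
      using M(1) that by (auto simp: sections_over_def)
    \<comment> \<open>This includes y outside \<open>J D ss\<close>: the fibre is then empty, both
      restrictions are the empty family, and injectivity still gives zero.\<close>
    have M0: "M y = \<zero>\<^bsub>stalk ?B y\<^esub>" if y: "y \<in> carrier W" "y \<noteq> x" for y
    proof -
      have "\<phi>\<^sub>x y (M y) = restrict f (subsequences_at D ss y)"
        using local[OF y(1) M(1)] M(2) by simp
      also have "\<dots> = \<phi>\<^sub>x y \<zero>\<^bsub>stalk ?B y\<^esub>"
        unfolding zero[OF y(1)] using y(2)
        by (intro restrict_ext vanish) (auto simp: subsequences_at_def)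
      finally show ?thesis
        using inj_onD[OF inj[OF y(1)]] stalks zero_stalk y(1) by blast
    qed
    \<comment> \<open>The other end of E differs from x, so M is zero there, and the gluing
      condition carries this zero over to x.\<close>
    have "rho ?B x E (M x) = \<zero>\<^bsub>edge_stalk ?B E\<^esub>" if E: "E \<in> edges G" "x \<in> ends E" for E
    proof -
      have "ends E \<subseteq> carrier W"
        using ends_closed[OF E(1)] by blast
      then have glue: "rho ?B (edge_source E) E (M (edge_source E))
          = rho ?B (edge_target E) E (M (edge_target E))"
        using M(1) E(1) by (simp add: sections_over_def)
      have ne: "edge_source E \<noteq> edge_target E"
        using E(1) by (rule edge_source_neq_target)
      have "\<exists>y\<in>ends E. y \<noteq> x \<and> rho ?B x E (M x) = rho ?B y E (M y)"
      proof (cases "x = edge_source E")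
        case True
        show ?thesis
          unfolding True by (rule bexI[of _ "edge_target E"]) (use ne glue in \<open>simp_all add: ends_def\<close>)
      next
        case False
        then have True: "x = edge_target E"
          using E(2) by (simp add: ends_def)
        show ?thesis
          unfolding True by (rule bexI[of _ "edge_source E"]) (use ne glue in \<open>simp_all add: ends_def\<close>)
      qed
      then obtain y where y: "y \<in> ends E" "y \<noteq> x" and "rho ?B x E (M x) = rho ?B y E (M y)"
        by blast
      then show ?thesis
        using M0[OF ends_closed[OF E(1) y(1)] y(2)] zero_rho[OF E(1) y(1)] by simp
    qed
    then have "M x \<in> carrier (costalk G ?B x)"
      using stalks[OF assms(11)] by (simp add: costalk_def restrict_module_def)
    moreover have "g = \<phi>\<^sub>x x (M x)"
      using local[OF assms(11) M(1)] f(2) M(2) by simp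
    ultimately show "g \<in> \<phi>\<^sub>x x ` carrier (costalk G ?B x)"
      by blast
  qed
  then have "bij_betw (\<phi>\<^sub>x x) (carrier (costalk G ?B x)) (carrier (X_costalk D ss x))"
    using inj_on_subset[OF inj[OF assms(11)] sub] by (simp add: bij_betw_def)
  \<comment> \<open>Costalks keep the operations of the stalks, so compatibility with sums and
    scalars is inherited.\<close>
  then show ?thesis
    using assms(9)[OF assms(11)] sub
    by (auto simp: module_iso_def costalk_def restrict_module_def X_costalk_def X_stalk_def)
qed

end
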